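(* Let $n \ge 9$ and let $\rho: B_n \to GL_n(\mathbb{C})$ be an irreducible complex representation of dimension $n$. Then $\rho$ is equivalent to a tensor product $\chi(y) \otimes \rho'$, where $y \in \mathbb{C}^*$, $\chi(y)$ is the one-dimensional representation with $\chi(y)(\sigma_i) = y$ for all $i$, and $\rho': B_n \to GL_n(\mathbb{C})$ is an $n$-dimensional representation of corank $2$. Equivalently, there exists $y \in \mathbb{C}^*$ with $\mathrm{rank}(\rho(\sigma_1) - yI) = 2$. *)

theory Defs
  imports "HOL-Analysis.Analysis"
begin

text \<open>A representation of the braid group B_n (generators sigma_1, ..., sigma_(n-1))
  on the space 'a^'d is given by the images A i of the standard generators
  sigma_i (1 <= i <= n-1): invertible matrices satisfying the braid relations.\<close>

definition braid_rep :: "nat \<Rightarrow> (nat \<Rightarrow> 'a::field^'d^'d) \<Rightarrow> bool" where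
  "braid_rep n A \<longleftrightarrow>
     (\<forall>i\<in>{1..<n}. invertible (A i)) \<and>
     (\<forall>i. 1 \<le> i \<and> i + 1 < n \<longrightarrow> A i ** A (i+1) ** A i = A (i+1) ** A i ** A (i+1)) \<and>
     (\<forall>i j. 1 \<le> i \<and> j < n \<and> i + 2 \<le> j \<longrightarrow> A i ** A j = A j ** A i)"

definition irreducible_braid_rep :: "nat \<Rightarrow> (nat \<Rightarrow> 'a::field^'d^'d) \<Rightarrow> bool" where
  "irreducible_braid_rep n A \<longleftrightarrow> braid_rep n A \<and>
     (\<forall>V. vec.subspace V \<and> (\<forall>i\<in>{1..<n}. \<forall>v\<in>V. A i *v v \<in> V)
            \<longrightarrow> V = {0} \<or> V = UNIV)"

definition equiv_braid_rep :: "nat \<Rightarrow> (nat \<Rightarrow> 'a::field^'d^'d) \<Rightarrow> (nat \<Rightarrow> 'a^'d^'d) \<Rightarrow> bool" where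
  "equiv_braid_rep n A B \<longleftrightarrow>
     (\<exists>P. invertible P \<and> (\<forall>i\<in>{1..<n}. P ** A i = B i ** P))"

definition chi_tensor :: "'a::field \<Rightarrow> (nat \<Rightarrow> 'a^'d^'d) \<Rightarrow> (nat \<Rightarrow> 'a^'d^'d)" where
  "chi_tensor y B = (\<lambda>i. mat y ** B i)"

definition braid_corank :: "(nat \<Rightarrow> 'a::field^'d^'d) \<Rightarrow> nat" where
  "braid_corank B = rank (B 1 - mat 1)"

end

theory Submission
  imports Defs "HOL-Computational_Algebra.Fundamental_Theorem_Algebra"
begin

text \<open>
  A subquotient of dimension at most \<open>m - 3\<close> of a representation of the braid group on \<open>m \<ge> 5\<close> strings
  has all generators acting by the same operator. This is shown by induction on the dimension: an
  eigenspace of \<open>A 1\<close> is stable under \<open>A 3, \<dots>, A (m - 1)\<close>, a braid group on \<open>m - 2\<close> strings; when the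
  eigenspace has dimension or codimension one, translating a stable line produces \<open>m - 2\<close>
  independent vectors, which is too many.

  Applied to the generators commuting with \<open>A 1\<close> in an irreducible representation of dimension \<open>n\<close>,
  this yields an eigenvalue \<open>y\<close> with \<open>r = rank (A 1 - mat y) \<le> 4\<close>. For \<open>n \<ge> 9\<close> it applies once more to
  the range of \<open>A 1 - mat y\<close> and, with irreducibility, shows that \<open>N i = A i - mat y\<close> and \<open>N j\<close>
  annihilate each other for \<open>\<bar>i - j\<bar> \<ge> 2\<close>. Then the ranges of \<open>N i\<close> with \<open>i\<close> congruent to \<open>1\<close> or \<open>3\<close>
  modulo \<open>5\<close> are independent, so \<open>2 r (n - 1) \<le> 5 n\<close>; the ranges of all \<open>N i\<close> span, so
  \<open>n \<le> r (n - 1)\<close>. Hence \<open>r = 2\<close>.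
\<close>

section \<open>Linear algebra over a field\<close>

text \<open>Rank-nullity on a subspace: a basis \<open>B\<close> of the kernel extends to a basis
  \<open>C\<close> of \<open>S\<close>, and \<open>M\<close> is injective on the span of
  \<open>C - B\<close>, whose image is that of \<open>S\<close>.\<close>

lemma dim_image_kernel:
  fixes M :: "'a::field^'n^'m"
  assumes S: "vec.subspace S"
  shows "vec.dim S = vec.dim ((*v) M ` S) + vec.dim {x \<in> S. M *v x = 0}"
proof -
  let ?K = "{x \<in> S. M *v x = 0}"
  have K: "vec.subspace ?K"
    using S by (auto simp: vec.subspace_def matrix_vector_right_distrib vector_scalar_commute)
  obtain B where B: "B \<subseteq> ?K" "vec.independent B" "?K \<subseteq> vec.span B" "card B = vec.dim ?K"
    using vec.basis_exists by blast
  have "B \<subseteq> S" using B(1) by auto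
  obtain C where C: "B \<subseteq> C" "C \<subseteq> S" "vec.independent C" "S \<subseteq> vec.span C"
    using vec.maximal_independent_subset_extend[OF \<open>B \<subseteq> S\<close> B(2)] by blast
  have finC: "finite C" using C(3) by (rule vec.finiteI_independent)
  have CB: "vec.independent (C - B)"
    using C(3) by (rule vec.independent_mono) auto
  have dimS: "vec.dim S = card C"
    using C by (intro vec.dim_unique) auto
  have spanC: "vec.span C = {x + y |x y. x \<in> vec.span B \<and> y \<in> vec.span (C - B)}"
  proof -
    have "C = B \<union> (C - B)" using C(1) by auto
    then show ?thesis using vec.span_Un[of B "C - B"] by metis
  qed
  have "vec.dim (vec.span C) + vec.dim (vec.span B \<inter> vec.span (C - B))
      = vec.dim (vec.span B) + vec.dim (vec.span (C - B))"
    unfolding spanC by (rule vec.dim_sums_Int) auto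
  moreover have "card C = card B + card (C - B)"
    using C(1) finC by (metis card_Diff_subset card_mono finite_subset le_add_diff_inverse)
  ultimately have "vec.dim (vec.span B \<inter> vec.span (C - B)) = 0"
    using vec.dim_eq_card_independent[OF C(3)] vec.dim_eq_card_independent[OF B(2)]
      vec.dim_eq_card_independent[OF CB] by simp
  then have Int: "vec.span B \<inter> vec.span (C - B) \<subseteq> {0}"
    by (simp add: vec.dim_eq_0)
  have "x = 0" if x: "x \<in> vec.span (C - B)" "M *v x = 0" for x
  proof -
    have "vec.span (C - B) \<subseteq> S"
      using C(2) S by (intro vec.span_minimal) auto
    then have "x \<in> ?K" using x by auto
    then show ?thesis using B(3) Int x(1) by auto
  qed
  then have "inj_on ((*v) M) (vec.span (C - B))"
    by (subst vec.linear_inj_on_iff_eq_0) auto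
  then have 1: "vec.dim ((*v) M ` (C - B)) = card (C - B)"
    using vec.dim_image_eq[OF matrix_vector_mul_linear_gen, of M "C - B"] vec.dim_eq_card_independent[OF CB]
    by simp
  have "(*v) M ` S \<subseteq> vec.span ((*v) M ` (C - B))"
  proof
    fix z assume "z \<in> (*v) M ` S"
    then obtain x where x: "x \<in> S" "z = M *v x" by auto
    then obtain b c where bc: "x = b + c" "b \<in> vec.span B" "c \<in> vec.span (C - B)"
      using C(4) spanC by blast
    have "b \<in> ?K" using vec.span_minimal[OF B(1) K] bc(2) by auto
    then have "z = M *v c" using x bc(1) by (simp add: matrix_vector_right_distrib)
    then show "z \<in> vec.span ((*v) M ` (C - B))"
      using bc(3) by (simp add: vec.span_image)
  qed
  moreover have "(*v) M ` (C - B) \<subseteq> (*v) M ` S" using C(2) by auto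
  ultimately have "vec.dim ((*v) M ` S) = card (C - B)"
    using 1 by (metis vec.dim_span vec.dim_subset vec.span_mono vec.span_span order_antisym)
  then show ?thesis
    using dimS \<open>card C = card B + card (C - B)\<close> B(4) by simp
qed

section \<open>Rank as the dimension of the range\<close>

lemma matrix_vector_mult_axis:
  fixes M :: "'a::semiring_1^'n^'m"
  shows "M *v axis j 1 = column j M"
  by (simp add: vec_eq_iff column_def matrix_vector_mult_def axis_def if_distrib cong: if_cong)

text \<open>Expanding the columns in a basis \<open>B\<close> of the range factors \<open>M\<close>
  through a space of dimension \<open>card B\<close>, so the rows are combinations of
  \<open>card B\<close> coefficient rows.\<close>

lemma dim_rows_le_dim_range:
  fixes M :: "'a::field^'n^'m"
  shows "vec.dim (rows M) \<le> vec.dim (range ((*v) M))"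
proof -
  obtain B where B: "B \<subseteq> range ((*v) M)" "vec.independent B" "range ((*v) M) \<subseteq> vec.span B"
    "card B = vec.dim (range ((*v) M))"
    using vec.basis_exists by blast
  have fin: "finite B" using B(2) by (rule vec.finiteI_independent)
  have "\<exists>u. (\<Sum>b\<in>B. u b *s b) = M *v axis j 1" for j
  proof -
    have "M *v axis j 1 \<in> vec.span B" using B(3) by auto
    then show ?thesis unfolding vec.span_finite[OF fin] by (auto simp: image_iff)
  qed
  then obtain u where u: "\<And>j. (\<Sum>b\<in>B. u j b *s b) = M *v axis j 1" by metis
  have entry: "M $ i $ j = (\<Sum>b\<in>B. u j b * b $ i)" for i j
  proof -
    have "M $ i $ j = (M *v axis j 1) $ i"
      by (simp add: matrix_vector_mult_axis column_def)
    then show ?thesis using u[of j, symmetric] by (simp add: sum_component)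
  qed
  have "rows M \<subseteq> vec.span ((\<lambda>b. \<chi> j. u j b) ` B)"
  proof
    fix x assume "x \<in> rows M"
    then obtain i where "x = row i M" by (auto simp: rows_def)
    then have "x = (\<Sum>b\<in>B. b $ i *s (\<chi> j. u j b))"
      by (simp add: vec_eq_iff row_def entry sum_component mult.commute)
    then show "x \<in> vec.span ((\<lambda>b. \<chi> j. u j b) ` B)"
      by (simp only:) (intro vec.span_sum vec.span_scale vec.span_base imageI)
  qed
  then have "vec.dim (rows M) \<le> card ((\<lambda>b. \<chi> j. u j b) ` B)"
    using fin by (intro vec.dim_le_card) auto
  also have "\<dots> \<le> vec.dim (range ((*v) M))"
    using card_image_le[OF fin] B(4) by metis
  finally show ?thesis .
qed

lemma dim_range_eq_dim_columns:
  fixes M :: "'a::field^'n^'m"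
  shows "vec.dim (range ((*v) M)) = vec.dim (columns M)"
proof (rule antisym)
  have col: "column i M \<in> columns M" for i
    by (auto simp: columns_def)
  have "range ((*v) M) \<subseteq> vec.span (columns M)"
  proof
    fix y assume "y \<in> range ((*v) M)"
    then obtain x where "y = M *v x" by auto
    then show "y \<in> vec.span (columns M)"
      unfolding matrix_mult_sum
      by (simp only:) (intro vec.span_sum vec.span_scale vec.span_base col)
  qed
  then show "vec.dim (range ((*v) M)) \<le> vec.dim (columns M)"
    by (metis vec.dim_subset vec.dim_span)
  have "columns M \<subseteq> range ((*v) M)"
    by (auto simp: columns_def matrix_vector_mult_axis[symmetric])
  then show "vec.dim (columns M) \<le> vec.dim (range ((*v) M))"
    by (rule vec.dim_subset)
qed

text \<open>\<open>rank\<close> is the row rank; the inequality between rows and range is applied to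
  \<open>M\<close> and to its transpose.\<close>

lemma rank_eq_dim_range:
  fixes M :: "'a::field^'n^'m"
  shows "rank M = vec.dim (range ((*v) M))"
proof (rule antisym)
  show "rank M \<le> vec.dim (range ((*v) M))"
    by (simp add: row_rank_def_gen dim_rows_le_dim_range)
  have "vec.dim (range ((*v) M)) = vec.dim (rows (transpose M))"
    by (simp add: dim_range_eq_dim_columns rows_transpose)
  also have "\<dots> \<le> vec.dim (range ((*v) (transpose M)))"
    by (rule dim_rows_le_dim_range)
  also have "\<dots> = rank M"
    unfolding dim_range_eq_dim_columns row_rank_def_gen columns_transpose ..
  finally show "vec.dim (range ((*v) M)) \<le> rank M" .
qed

text \<open>Rank-nullity for \<open>M\<close> on the preimage of \<open>X\<close> and on the whole
  space; the kernel of the former lies in that of the latter.\<close>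

lemma dim_vimage_le:
  fixes M :: "'a::field^'n^'n"
  assumes X: "vec.subspace X"
  shows "vec.dim {x. M *v x \<in> X} + rank M \<le> vec.dim X + CARD('n)"
proof -
  let ?E = "{x. M *v x \<in> X}"
  have E: "vec.subspace ?E"
    using X by (auto simp: vec.subspace_def matrix_vector_right_distrib vector_scalar_commute)
  have "vec.dim ?E = vec.dim ((*v) M ` ?E) + vec.dim {x \<in> ?E. M *v x = 0}"
    by (rule dim_image_kernel[OF E])
  moreover have "vec.dim ((*v) M ` ?E) \<le> vec.dim X"
    by (rule vec.dim_subset) auto
  moreover have "vec.dim {x \<in> ?E. M *v x = 0} \<le> vec.dim {x. M *v x = 0}"
    by (rule vec.dim_subset) auto
  moreover have "CARD('n) = rank M + vec.dim {x. M *v x = 0}"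
    using dim_image_kernel[OF vec.subspace_UNIV, of M]
    by (simp add: rank_eq_dim_range card_cart_basis)
  ultimately show ?thesis by linarith
qed

lemma dim_insert_subspace:
  fixes x :: "'a::field^'n"
  assumes "vec.subspace U" "x \<notin> U"
  shows "vec.dim (vec.span (insert x U)) = vec.dim U + 1"
  using assms by (metis vec.dim_insert vec.dim_span vec.span_eq_iff)

text \<open>Split off a root of a polynomial \<open>p\<close> of minimal degree for which \<open>p(M)\<close> sends a given vector
  into \<open>U\<close>.\<close>

lemma eigenvector_subquotient:
  fixes M :: "complex^'n^'n"
  assumes U: "vec.subspace U" and W: "vec.subspace W" and UW: "U \<subset> W"
    and MW: "\<And>w. w \<in> W \<Longrightarrow> M *v w \<in> W"
  obtains c w where "w \<in> W" "w \<notin> U" "M *v w - c *s w \<in> U"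
proof -
  \<comment> \<open>\<open>ev p v\<close> is the vector p(M) v.\<close>
  define ev where "ev p v = (\<Sum>i\<le>degree p. coeff p i *s (((*v) M ^^ i) v))" for p v
  have ev_bound: "ev p v = (\<Sum>i\<le>k. coeff p i *s (((*v) M ^^ i) v))" if "degree p \<le> k" for p v k
    unfolding ev_def using that by (intro sum.mono_neutral_left) (auto simp: coeff_eq_0)
  have ev_factor: "ev ([:-c, 1:] * q) v = M *v ev q v - c *s ev q v" for c q v
  proof -
    let ?k = "Suc (degree q)"
    have "degree ([:-c, 1:] * q) \<le> ?k"
      using degree_mult_le[of "[:-c, 1:]" q] by simp
    then have "ev ([:-c, 1:] * q) v = (\<Sum>i\<le>?k. coeff ([:-c, 1:] * q) i *s (((*v) M ^^ i) v))"
      by (rule ev_bound)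
    also have "\<dots> = (\<Sum>i\<le>?k. coeff (pCons 0 q) i *s (((*v) M ^^ i) v))
        - (\<Sum>i\<le>?k. (c * coeff q i) *s (((*v) M ^^ i) v))"
      by (simp add: sum_subtractf[symmetric] vec.scale_left_diff_distrib del: sum.atMost_Suc)
    also have "(\<Sum>i\<le>?k. coeff (pCons 0 q) i *s (((*v) M ^^ i) v)) = M *v ev q v"
      unfolding ev_def
      by (simp add: sum.atMost_Suc_shift vec.linear_sum[OF matrix_vector_mul_linear_gen]
          vector_scalar_commute del: sum.atMost_Suc)
    also have "(\<Sum>i\<le>?k. (c * coeff q i) *s (((*v) M ^^ i) v)) = c *s ev q v"
      using ev_bound[of q ?k v]
      by (simp add: vec.scale_sum_right del: sum.atMost_Suc)
    finally show ?thesis .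
  qed
  obtain w where w: "w \<in> W" "w \<notin> U" using UW by auto
  have pow: "((*v) M ^^ i) w \<in> W" for i
    by (induction i) (auto simp: w MW)
  have evW: "ev p w \<in> W" for p
    unfolding ev_def using W pow by (intro vec.subspace_sum vec.subspace_scale) auto
  have "\<exists>p. p \<noteq> 0 \<and> ev p w \<in> U"
  \<comment> \<open>Linear dependence concerns the set of iterates. If they are distinct, there are
    too many to be independent; a coincidence of two gives a difference of monomials
    instead.\<close>
  proof (cases "inj_on (\<lambda>i. ((*v) M ^^ i) w) {..CARD('n)}")
    case True
    let ?f = "\<lambda>i. ((*v) M ^^ i) w"
    have "\<not> vec.independent (?f ` {..CARD('n)})"
    proof
      assume "vec.independent (?f ` {..CARD('n)})"
      then have "card (?f ` {..CARD('n)}) \<le> CARD('n)"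
        by (metis vec.dim_eq_card_independent dim_subset_UNIV_cart_gen)
      then show False by (simp add: card_image[OF True])
    qed
    then have "\<exists>u. (\<exists>v\<in>?f ` {..CARD('n)}. u v \<noteq> 0) \<and> (\<Sum>v\<in>?f ` {..CARD('n)}. u v *s v) = 0"
      unfolding vec.dependent_finite[OF finite_imageI[OF finite_atMost]] not_not .
    then obtain u where u: "(\<Sum>v\<in>?f ` {..CARD('n)}. u v *s v) = 0" "\<exists>v\<in>?f ` {..CARD('n)}. u v \<noteq> 0"
      by (elim exE conjE)
    define p where "p = (\<Sum>i\<le>CARD('n). monom (u (?f i)) i)"
    have cp: "coeff p i = (if i \<le> CARD('n) then u (?f i) else 0)" for i
      by (simp add: p_def coeff_sum)
    obtain i where "i \<le> CARD('n)" "u (?f i) \<noteq> 0" using u(2) by blast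
    then have "coeff p i \<noteq> 0" by (simp add: cp)
    then have "p \<noteq> 0" by auto
    moreover have "degree p \<le> CARD('n)"
      by (rule degree_le) (simp add: cp)
    then have "ev p w = (\<Sum>i\<le>CARD('n). u (?f i) *s ?f i)"
      by (simp add: ev_bound cp)
    then have "ev p w = 0"
      using u(1) by (simp add: sum.reindex[OF True])
    ultimately show ?thesis using vec.subspace_0[OF U] by metis
  next
    case False
    then obtain i j where ij: "i < j" "((*v) M ^^ i) w = ((*v) M ^^ j) w"
      unfolding inj_on_def by (metis nat_neq_iff)
    define p :: "complex poly" where "p = monom 1 j - monom 1 i"
    have "coeff p j = 1" using ij(1) by (simp add: p_def)
    then have "p \<noteq> 0" by auto
    moreover have "degree p \<le> j"
      by (rule degree_le) (use ij(1) in \<open>auto simp: p_def\<close>)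
    then have "ev p w = (\<Sum>k\<le>j. (if k = j then ((*v) M ^^ k) w else 0) - (if k = i then ((*v) M ^^ k) w else 0))"
      by (auto simp: ev_bound p_def vec.scale_left_diff_distrib intro!: sum.cong)
    then have "ev p w = 0"
      using ij by (simp add: sum_subtractf)
    ultimately show ?thesis using vec.subspace_0[OF U] by metis
  qed
  then obtain p where p: "p \<noteq> 0" "ev p w \<in> U"
    and least: "\<And>q. q \<noteq> 0 \<Longrightarrow> ev q w \<in> U \<Longrightarrow> degree p \<le> degree q"
    using ex_has_least_nat[of "\<lambda>p. p \<noteq> 0 \<and> ev p w \<in> U" _ degree] by blast
  have "degree p \<noteq> 0"
  proof
    assume "degree p = 0"
    then obtain a where a: "p = [:a:]" "a \<noteq> 0" using p(1) by (metis degree_eq_zeroE pCons_0_0)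
    then have "inverse a *s ev p w = w" by (simp add: ev_def)
    then show False using vec.subspace_scale[OF U p(2)] w(2) by metis
  qed
  then obtain c where "poly p c = 0"
    using fundamental_theorem_of_algebra[of p] by (auto simp: constant_degree)
  then obtain q where q: "p = [:-c, 1:] * q" by (metis poly_eq_0_iff_dvd dvdE)
  have "q \<noteq> 0" using p(1) q by auto
  then have "degree p = Suc (degree q)"
    unfolding q by (subst degree_mult_eq) auto
  then have "ev q w \<notin> U" using least \<open>q \<noteq> 0\<close> by fastforce
  moreover have "M *v ev q w - c *s ev q w \<in> U"
    using p(2) unfolding q ev_factor .
  ultimately show thesis using that evW by blast
qed

lemma mat_mult_vector [simp]:
  fixes x :: "'a::field^'n"
  shows "mat c *v x = c *s x"
  by (simp add: vec_eq_iff matrix_vector_mult_def mat_def if_distrib if_distribR cong: if_cong)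

lemma mat_mult_commute:
  fixes M :: "'a::field^'n^'n"
  shows "mat c ** M = M ** mat c"
  unfolding matrix_eq by (simp add: matrix_vector_mul_assoc[symmetric] vector_scalar_commute)

section \<open>Braid generators on subquotients\<close>

text \<open>Stands in for quotient spaces: if \<open>M\<close> and \<open>N\<close> preserve
  \<open>U \<subseteq> W\<close>, then \<open>maps_into (M - N) W U\<close> says that they induce
  the same operator on W/U.\<close>

definition maps_into :: "'a::field^'n^'n \<Rightarrow> ('a^'n) set \<Rightarrow> ('a^'n) set \<Rightarrow> bool" where
  "maps_into M W U \<longleftrightarrow> (\<forall>w\<in>W. M *v w \<in> U)"

lemma maps_into_mult: "maps_into M W X \<Longrightarrow> maps_into N X U \<Longrightarrow> maps_into (N ** M) W U"
  by (simp add: maps_into_def matrix_vector_mul_assoc[symmetric])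

lemma maps_into_diff:
  "vec.subspace U \<Longrightarrow> maps_into M W U \<Longrightarrow> maps_into N W U \<Longrightarrow> maps_into (M - N) W U"
  by (simp add: maps_into_def matrix_vector_mult_diff_rdistrib vec.subspace_diff)

lemma maps_into_add:
  "vec.subspace U \<Longrightarrow> maps_into M W U \<Longrightarrow> maps_into N W U \<Longrightarrow> maps_into (M + N) W U"
  by (simp add: maps_into_def matrix_vector_mult_add_rdistrib vec.subspace_add)

lemma maps_into_diff_trans:
  assumes "vec.subspace U" "maps_into (M - N) W U" "maps_into (N - P) W U"
  shows "maps_into (M - P) W U"
  using maps_into_add[OF assms] by simp

lemma maps_into_diff_sym:
  assumes "vec.subspace U" "maps_into (M - N) W U"
  shows "maps_into (N - M) W U"
  unfolding maps_into_def
proof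
  fix w assume "w \<in> W"
  then have "- ((M - N) *v w) \<in> U"
    using assms by (intro vec.subspace_neg) (auto simp: maps_into_def)
  then show "(N - M) *v w \<in> U" by (simp add: matrix_vector_mult_diff_rdistrib)
qed

text \<open>In finite dimension an injective map of \<open>U\<close> into itself is onto, so
  \<open>M\<close> can be cancelled modulo \<open>U\<close>.\<close>

lemma mem_if_invertible_image_mem:
  fixes M :: "'a::field^'n^'n"
  assumes M: "invertible M" and U: "vec.subspace U" and MU: "maps_into M U U" and x: "M *v x \<in> U"
  shows "x \<in> U"
proof -
  have inj: "inj ((*v) M)" using M by (rule inj_matrix_vector_mult)
  then have "vec.dim ((*v) M ` U) = vec.dim U"
    by (intro vec.dim_image_eq) (auto intro: inj_on_subset)
  then have "(*v) M ` U = U"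
    using U MU by (intro vec.subspace_dim_equal vec.linear_subspace_image) (auto simp: maps_into_def)
  then show ?thesis using x inj by (metis imageE injD)
qed

text \<open>The braid relation gives XY(Y - X) = (XY - YX)Y, and XY can be cancelled modulo
  \<open>U\<close>.\<close>

lemma braid_commute_imp_agree:
  fixes X Y :: "'a::field^'n^'n"
  assumes comm: "maps_into (X ** Y - Y ** X) W U"
    and braid: "X ** Y ** X = Y ** X ** Y"
    and U: "vec.subspace U" and inv: "invertible X" "invertible Y"
    and XU: "maps_into X U U" and YU: "maps_into Y U U" and YW: "maps_into Y W W"
  shows "maps_into (Y - X) W U"
  unfolding maps_into_def
proof
  fix w assume w: "w \<in> W"
  have "X *v (Y *v ((Y - X) *v w)) = (X ** Y - Y ** X) *v (Y *v w)"
    using arg_cong[OF braid, of "\<lambda>M. M *v w"]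
    by (simp add: matrix_vector_mul_assoc[symmetric] algebra_simps)
  then have "X *v (Y *v ((Y - X) *v w)) \<in> U"
    using comm YW w by (simp add: maps_into_def)
  then show "(Y - X) *v w \<in> U"
    using U inv XU YU by (blast dest: mem_if_invertible_image_mem)
qed

text \<open>Replacing \<open>X\<close> by \<open>X'\<close> shows that \<open>X\<close> and
  \<open>Y\<close> commute on the subquotient, and commuting braid partners agree.\<close>

lemma braid_agree:
  fixes X X' Y :: "'a::field^'n^'n"
  assumes agree: "maps_into (X - X') W U" and comm: "Y ** X' = X' ** Y"
    and braid: "X ** Y ** X = Y ** X ** Y"
    and U: "vec.subspace U" and inv: "invertible X" "invertible Y"
    and XU: "maps_into X U U" and YU: "maps_into Y U U" and YW: "maps_into Y W W"
  shows "maps_into (Y - X) W U"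
proof (rule braid_commute_imp_agree[OF _ braid U inv XU YU YW])
  have "X ** Y - Y ** X = (X - X') ** Y - Y ** (X - X')"
    using arg_cong[OF comm, of "\<lambda>M. M *v x" for x] unfolding matrix_eq
    by (simp add: matrix_vector_mul_assoc[symmetric] algebra_simps)
  then show "maps_into (X ** Y - Y ** X) W U"
    by (simp only:)
       (rule maps_into_diff[OF U maps_into_mult[OF YW agree] maps_into_mult[OF agree YU]])
qed

section \<open>Representations and agreement of their generators\<close>

lemma braid_rep_invertible: "braid_rep n A \<Longrightarrow> 1 \<le> i \<Longrightarrow> i < n \<Longrightarrow> invertible (A i)"
  by (simp add: braid_rep_def)

lemma braid_rep_braid:
  "braid_rep n A \<Longrightarrow> 1 \<le> i \<Longrightarrow> Suc i < n \<Longrightarrow>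
    A i ** A (Suc i) ** A i = A (Suc i) ** A i ** A (Suc i)"
  by (simp add: braid_rep_def)

lemma braid_rep_commute:
  assumes "braid_rep n A" "1 \<le> i" "i < n" "1 \<le> j" "j < n" "i + 2 \<le> j \<or> j + 2 \<le> i \<or> i = j"
  shows "A i ** A j = A j ** A i"
  using assms unfolding braid_rep_def by metis

lemma braid_rep_shift: "braid_rep n A \<Longrightarrow> braid_rep (n - 2) (\<lambda>i. A (i + 2))"
  by (auto simp: braid_rep_def less_diff_conv intro!: braid_rep_commute[of n A])

text \<open>Transfers results about \<open>A 1\<close> to the other end,
  \<open>A (n - 1)\<close>.\<close>

lemma braid_rep_reverse:
  assumes "braid_rep n A"
  shows "braid_rep n (\<lambda>i. A (n - i))"
  unfolding braid_rep_def
proof (intro conjI ballI allI impI)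
  fix i assume "i \<in> {1..<n}"
  then show "invertible (A (n - i))"
    using braid_rep_invertible[OF assms, of "n - i"] by auto
next
  fix i assume i: "1 \<le> i \<and> i + 1 < n"
  have "Suc (n - (i + 1)) = n - i" using i by auto
  then show "A (n - i) ** A (n - (i + 1)) ** A (n - i) = A (n - (i + 1)) ** A (n - i) ** A (n - (i + 1))"
    using braid_rep_braid[OF assms, of "n - (i + 1)"] i by auto
next
  fix i j assume "1 \<le> i \<and> j < n \<and> i + 2 \<le> j"
  then show "A (n - i) ** A (n - j) = A (n - j) ** A (n - i)"
    by (intro braid_rep_commute[OF assms]) auto
qed

definition invariant :: "nat \<Rightarrow> (nat \<Rightarrow> 'a::field^'n^'n) \<Rightarrow> ('a^'n) set \<Rightarrow> bool" where
  "invariant n A U \<longleftrightarrow> vec.subspace U \<and> (\<forall>i\<in>{1..<n}. maps_into (A i) U U)"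

lemma invariant_shift: "invariant n A U \<Longrightarrow> invariant (n - 2) (\<lambda>i. A (i + 2)) U"
  unfolding invariant_def by auto

definition agree_mod :: "nat \<Rightarrow> (nat \<Rightarrow> 'a::field^'n^'n) \<Rightarrow> ('a^'n) set \<Rightarrow> ('a^'n) set \<Rightarrow> bool" where
  "agree_mod n A W U \<longleftrightarrow> (\<forall>i\<in>{1..<n}. \<forall>j\<in>{1..<n}. maps_into (A i - A j) W U)"

text \<open>Agreement spreads in both directions: \<open>A (i + 2)\<close> commutes with
  \<open>A i\<close>, so once \<open>A i\<close> and \<open>A (i + 1)\<close> agree,
  \<open>braid_agree\<close> adds \<open>A (i + 2)\<close>, and symmetrically downwards.\<close>

lemma agree_mod_if_adjacent_agree:
  assumes A: "braid_rep n A" and U: "invariant n A U" and W: "invariant n A W"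
    and k: "1 \<le> k" "Suc k < n" "maps_into (A k - A (Suc k)) W U"
  shows "agree_mod n A W U"
proof -
  have sU: "vec.subspace U" using U by (simp add: invariant_def)
  note sym = maps_into_diff_sym[OF sU] and trans = maps_into_diff_trans[OF sU]
  have mU: "maps_into (A i) U U" and mW: "maps_into (A i) W W" if "1 \<le> i" "i < n" for i
    using U W that by (auto simp: invariant_def)
  have up: "maps_into (A i - A (Suc i)) W U" if "k \<le> i" "Suc i < n" for i
    using that
  proof (induction i rule: dec_induct)
    case base
    then show ?case using k by simp
  next
    case (step i)
    have i: "1 \<le> i" "Suc (Suc i) < n" using step k by auto
    have agree: "maps_into (A (Suc i) - A i) W U" by (rule sym) (use step in auto)
    have comm: "A (Suc (Suc i)) ** A i = A i ** A (Suc (Suc i))"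
      by (rule braid_rep_commute[OF A]) (use i in auto)
    have "maps_into (A (Suc (Suc i)) - A (Suc i)) W U"
      by (rule braid_agree[OF agree comm braid_rep_braid[OF A] sU])
         (use i in \<open>auto intro!: mU mW braid_rep_invertible[OF A]\<close>)
    then show ?case by (rule sym)
  qed
  have down: "maps_into (A i - A (Suc i)) W U" if "i \<le> k" "1 \<le> i" for i
    using that
  proof (induction i rule: inc_induct)
    case base
    then show ?case using k by simp
  next
    case (step i)
    have i: "1 \<le> i" "Suc (Suc i) < n" using step k by auto
    have agree: "maps_into (A (Suc i) - A (Suc (Suc i))) W U" using step by auto
    have comm: "A i ** A (Suc (Suc i)) = A (Suc (Suc i)) ** A i"
      by (rule braid_rep_commute[OF A]) (use i in auto)
    show ?case
      by (rule braid_agree[OF agree comm braid_rep_braid[OF A, symmetric] sU])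
         (use i in \<open>auto intro!: mU mW braid_rep_invertible[OF A]\<close>)
  qed
  have adj: "maps_into (A i - A (Suc i)) W U" if "1 \<le> i" "Suc i < n" for i
    using up down that by (meson nat_le_linear)
  have first: "maps_into (A 1 - A i) W U" if "1 \<le> i" "i < n" for i
    using that
  proof (induction i rule: dec_induct)
    case base
    then show ?case using sU by (simp add: maps_into_def vec.subspace_0)
  next
    case (step i)
    then show ?case using trans adj[of i] by auto
  qed
  show ?thesis
    unfolding agree_mod_def by (intro ballI trans[OF sym[OF first] first]) auto
qed

text \<open>This reflects that the commutator subgroup of the braid group on at least five strings is
  perfect. Concretely, \<open>[A 1, A 2] = [A 1 - A 4, A 2 - A 1]\<close>, and the right-hand side maps \<open>W\<close>
  through \<open>X\<close> into \<open>U\<close>.\<close>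

lemma agree_mod_glue:
  assumes A: "braid_rep n A" and n: "5 \<le> n"
    and U: "invariant n A U" and W: "invariant n A W"
    and WX: "agree_mod n A W X" and XU: "agree_mod n A X U"
  shows "agree_mod n A W U"
proof (rule agree_mod_if_adjacent_agree[OF A U W, of 1])
  have sU: "vec.subspace U" using U by (simp add: invariant_def)
  \<comment> \<open>This is where five strings enter: \<open>A 4\<close> is the first generator for
    which the relations give commutation with both \<open>A 1\<close> and
    \<open>A 2\<close>.\<close>
  have comm: "A 4 ** A 1 = A 1 ** A 4" "A 4 ** A 2 = A 2 ** A 4"
    using n by (auto intro!: braid_rep_commute[OF A])
  have "A 2 ** A 1 - A 1 ** A 2 = (A 2 - A 1) ** (A 1 - A 4) - (A 1 - A 4) ** (A 2 - A 1)"
    using arg_cong[OF comm(1), of "\<lambda>M. M *v x" for x] arg_cong[OF comm(2), of "\<lambda>M. M *v x" for x]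
    unfolding matrix_eq by (simp add: matrix_vector_mul_assoc[symmetric] algebra_simps)
  moreover have "maps_into (A 2 - A 1) W X" "maps_into (A 1 - A 4) W X"
    "maps_into (A 2 - A 1) X U" "maps_into (A 1 - A 4) X U"
    using WX XU n by (auto simp: agree_mod_def)
  ultimately have "maps_into (A 2 ** A 1 - A 1 ** A 2) W U"
    by (simp only:) (rule maps_into_diff[OF sU]; rule maps_into_mult)
  then have "maps_into (A 1 - A 2) W U"
  proof (rule braid_commute_imp_agree)
    show "A 2 ** A 1 ** A 2 = A 1 ** A 2 ** A 1"
      using n braid_rep_braid[OF A, of 1] by (simp add: numeral_2_eq_2)
  qed (use n U W sU in \<open>auto intro: braid_rep_invertible[OF A] simp: invariant_def\<close>)
  then show "maps_into (A 1 - A (Suc 1)) W U" by (simp add: numeral_2_eq_2)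
qed (use n in auto)

text \<open>A scalar matrix commutes with everything, so it can serve as \<open>X'\<close> in
  \<open>braid_agree\<close> and pass from each generator to the next.\<close>

lemma agree_mod_if_scalar:
  assumes A: "braid_rep n A" and U: "invariant n A U" and W: "invariant n A W"
    and scalar: "maps_into (A 1 - mat c) W U"
  shows "agree_mod n A W U"
proof -
  have sU: "vec.subspace U" using U by (simp add: invariant_def)
  have all: "maps_into (A i - mat c) W U" if "1 \<le> i" "i < n" for i
    using that
  proof (induction i rule: dec_induct)
    case base
    then show ?case using scalar by simp
  next
    case (step i)
    have "maps_into (A i - mat c) W U" using step by auto
    then have "maps_into (A (Suc i) - A i) W U"
      using step U W sU braid_rep_braid[OF A, of i]
      by (elim braid_agree[OF _ mat_mult_commute[symmetric]])
         (auto intro: braid_rep_invertible[OF A] simp: invariant_def)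
    then show ?case using step maps_into_diff_trans[OF sU] by auto
  qed
  show ?thesis
    unfolding agree_mod_def
    by (intro ballI maps_into_diff_trans[OF sU all maps_into_diff_sym[OF sU all]]) auto
qed

section \<open>Stable lines in irreducible subquotients\<close>

lemma dim_psubset_subspace:
  fixes S T :: "('a::field^'n) set"
  assumes "vec.subspace S" "vec.subspace T" "S \<subset> T"
  shows "vec.dim S < vec.dim T"
  using assms by (intro vec.dim_psubset) (simp add: vec.span_eq_iff[THEN iffD2])

lemma mem_span_insert_subspace:
  fixes U :: "('a::field^'n) set"
  assumes "vec.subspace U"
  shows "x \<in> vec.span (insert f U) \<longleftrightarrow> (\<exists>k. x - k *s f \<in> U)"
  using assms by (simp add: vec.span_insert vec.span_eq_iff[THEN iffD2])

lemma matrix_commute_vector: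
  fixes M N :: "'a::field^'n^'n"
  shows "M ** N = N ** M \<Longrightarrow> M *v (N *v x) = N *v (M *v x)"
  by (simp add: matrix_vector_mul_assoc)

lemma eigenvector_mod_mult:
  fixes M N :: "'a::field^'n^'n"
  assumes U: "vec.subspace U" and MU: "maps_into M U U"
    and M: "M *v f - a *s f \<in> U" and N: "N *v f - b *s f \<in> U"
  shows "(M ** N) *v f - (a * b) *s f \<in> U"
proof -
  have "(M ** N) *v f - (a * b) *s f = M *v (N *v f - b *s f) + b *s (M *v f - a *s f)"
    by (simp add: matrix_vector_mul_assoc[symmetric] matrix_vector_mult_diff_distrib
        vector_scalar_commute vec.scale_right_diff_distrib mult.commute)
  then show ?thesis
    using U MU M N by (simp only:) (intro vec.subspace_add vec.subspace_scale; simp add: maps_into_def)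
qed

text \<open>On a common eigenvector modulo \<open>U\<close> the braid relation reads xyx = yxy with
  nonzero scalars.\<close>

lemma braid_eigenvalues_eq:
  fixes X Y :: "'a::field^'n^'n"
  assumes U: "vec.subspace U" and XU: "maps_into X U U" and YU: "maps_into Y U U"
    and inv: "invertible X" "invertible Y" and braid: "X ** Y ** X = Y ** X ** Y"
    and f: "f \<notin> U" and X: "X *v f - x *s f \<in> U" and Y: "Y *v f - y *s f \<in> U"
  shows "x = y" "x \<noteq> 0"
proof -
  have "x \<noteq> 0" "y \<noteq> 0"
    using X Y f mem_if_invertible_image_mem[OF inv(1) U XU, of f]
      mem_if_invertible_image_mem[OF inv(2) U YU, of f] by auto
  have XY: "maps_into (X ** Y) U U" and YX: "maps_into (Y ** X) U U"
    using XU YU by (auto intro: maps_into_mult)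
  have "(X ** Y ** X) *v f - (x * y * x) *s f \<in> U" "(Y ** X ** Y) *v f - (y * x * y) *s f \<in> U"
    using eigenvector_mod_mult[OF U XY eigenvector_mod_mult[OF U XU X Y] X]
      eigenvector_mod_mult[OF U YX eigenvector_mod_mult[OF U YU Y X] Y] by auto
  then have "((Y ** X ** Y) *v f - (y * x * y) *s f) - ((X ** Y ** X) *v f - (x * y * x) *s f) \<in> U"
    using U by (simp add: vec.subspace_diff)
  moreover have "((Y ** X ** Y) *v f - (y * x * y) *s f) - ((X ** Y ** X) *v f - (x * y * x) *s f)
      = (x * y * (x - y)) *s f"
    by (simp add: braid vec.scale_left_diff_distrib algebra_simps)
  ultimately have m: "(x * y * (x - y)) *s f \<in> U" by simp
  show "x = y"
  proof (rule ccontr)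
    assume "x \<noteq> y"
    then have "x * y * (x - y) \<noteq> 0"
      using \<open>x \<noteq> 0\<close> \<open>y \<noteq> 0\<close> by simp
    then have "inverse (x * y * (x - y)) *s ((x * y * (x - y)) *s f) = f"
      by (metis left_inverse vec.scale_one vec.scale_scale)
    then show False using vec.subspace_scale[OF U m] f by metis
  qed
  show "x \<noteq> 0" by fact
qed

lemma maps_into_span_insert:
  fixes M :: "'a::field^'n^'n"
  assumes U: "vec.subspace U" and X: "vec.subspace X"
    and MU: "maps_into M U X" and f: "M *v f \<in> X"
  shows "maps_into M (vec.span (insert f U)) X"
  unfolding maps_into_def
proof
  fix x assume "x \<in> vec.span (insert f U)"
  then obtain k where k: "x - k *s f \<in> U" by (auto simp: mem_span_insert_subspace[OF U])
  have "M *v x = M *v (x - k *s f) + k *s (M *v f)"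
    by (simp add: matrix_vector_mult_diff_distrib vector_scalar_commute)
  then show "M *v x \<in> X"
    using MU f k X by (simp add: maps_into_def vec.subspace_add vec.subspace_scale)
qed

text \<open>Successive translates of \<open>f\<close> by \<open>A k ** A (Suc k)\<close> are linearly independent modulo \<open>U\<close>:
  the \<open>k\<close>-th one is the first not annihilated by \<open>A (k + 2) - mat a\<close>.\<close>

lemma dim_irreducible_subquotient_ge:
  fixes A :: "nat \<Rightarrow> 'a::field^'n^'n"
  assumes A: "braid_rep m A" and U: "invariant m A U" and W: "invariant m A W" and UW: "U \<subseteq> W"
    and irr: "\<And>X. invariant m A X \<Longrightarrow> U \<subseteq> X \<Longrightarrow> X \<subseteq> W \<Longrightarrow> X = U \<or> X = W"
    and dim: "vec.dim U + 2 \<le> vec.dim W"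
    and f: "f \<in> W" "f \<notin> U"
    and lines: "\<And>j. 1 \<le> j \<Longrightarrow> j < m \<Longrightarrow> j \<noteq> 2 \<Longrightarrow> \<exists>c. A j *v f - c *s f \<in> U"
  shows "vec.dim U + m \<le> vec.dim W + 2"
proof (cases "m \<le> 4")
  case True
  then show ?thesis using dim by linarith
next
  case False
  then have m: "5 \<le> m" by simp
  have sU: "vec.subspace U" and sW: "vec.subspace W"
    using U W by (auto simp: invariant_def)
  have mU: "maps_into (A i) U U" and mW: "maps_into (A i) W W" if "1 \<le> i" "i < m" for i
    using U W that by (auto simp: invariant_def)
  obtain c where c: "\<And>j. 1 \<le> j \<Longrightarrow> j < m \<Longrightarrow> j \<noteq> 2 \<Longrightarrow> A j *v f - c j *s f \<in> U"
    using lines by metis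
  \<comment> \<open>Adjacent generators from \<open>A 3\<close> on share this eigenvalue.
    \<open>A 1\<close> is not linked to them, since nothing is assumed about \<open>A 2\<close> on
    \<open>f\<close>.\<close>
  define a where "a = c 3"
  have cc: "c j = c (Suc j) \<and> c j \<noteq> 0" if "3 \<le> j" "Suc j < m" for j
    using braid_eigenvalues_eq[OF sU mU mU braid_rep_invertible[OF A] braid_rep_invertible[OF A]
        braid_rep_braid[OF A, of j] f(2) c[of j] c[of "Suc j"]] that
    by auto
  have ca: "c j = a" if "3 \<le> j" "j < m" for j
    using that by (induction j rule: dec_induct) (auto simp: a_def cc)
  have a0: "a \<noteq> 0" using cc[of 3] m by (auto simp: a_def)
  have fa: "(A j - mat a) *v f \<in> U" if "3 \<le> j" "j < m" for j
    using c[of j] ca[of j] that by (simp add: matrix_vector_mult_diff_rdistrib)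
  \<comment> \<open>Otherwise \<open>f\<close> would span, together with \<open>U\<close>, an
    invariant subspace of dimension one over \<open>U\<close>, against irreducibility.\<close>
  have fn: "(A 2 - mat a) *v f \<notin> U"
  proof
    assume 2: "(A 2 - mat a) *v f \<in> U"
    let ?X = "vec.span (insert f U)"
    have XW: "?X \<subseteq> W" using f UW sW by (intro vec.span_minimal) auto
    have sub: "U \<subseteq> ?X" and fX: "f \<in> ?X"
      by (auto intro: vec.span_base)
    have "maps_into (A j) ?X ?X" if j: "1 \<le> j" "j < m" for j
    proof (rule maps_into_span_insert[OF sU])
      show "maps_into (A j) U ?X" using mU[OF j] sub by (auto simp: maps_into_def)
      have "\<exists>c. A j *v f - c *s f \<in> U"
        using lines[OF j] 2 by (cases "j = 2") (auto simp: matrix_vector_mult_diff_rdistrib)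
      then show "A j *v f \<in> ?X" by (simp add: mem_span_insert_subspace[OF sU])
    qed auto
    then have "invariant m A ?X" by (auto simp: invariant_def)
    then have "?X = W" using irr[of ?X] XW sub fX f(2) by metis
    then show False using dim_insert_subspace[OF sU f(2)] dim by simp
  qed
  \<comment> \<open>\<open>S\<close> is spanned by \<open>U\<close> and the first \<open>k\<close>
    translates, and \<open>w\<close> is the next one. The bound on \<open>k\<close> ensures that the
    generator \<open>A (k + 2)\<close> exists.\<close>
  have chain: "\<exists>S w. vec.subspace S \<and> S \<subseteq> W \<and> vec.dim S = vec.dim U + k \<and> w \<in> W \<and>
      (\<forall>j. k + 2 \<le> j \<and> j < m \<longrightarrow> maps_into (A j - mat a) S U) \<and>
      (\<forall>j. k + 3 \<le> j \<and> j < m \<longrightarrow> (A j - mat a) *v w \<in> U) \<and> (A (k + 2) - mat a) *v w \<notin> U"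
    if "k + 3 \<le> m" for k
    using that
  proof (induction k)
    case 0
    have "maps_into (A j - mat a) U U" if "2 \<le> j" "j < m" for j
      using mU[of j] that sU
      by (intro maps_into_diff) (auto simp: maps_into_def vec.subspace_scale)
    then show ?case
      using sU UW f fa fn
      by (intro exI[of _ U] exI[of _ f]) (auto simp: numeral_2_eq_2 numeral_3_eq_3)
  next
    case (Suc k)
    then obtain S w where S: "vec.subspace S" "S \<subseteq> W" "vec.dim S = vec.dim U + k"
      and w: "w \<in> W" "(A (k + 2) - mat a) *v w \<notin> U"
      and SU: "\<And>j. k + 2 \<le> j \<Longrightarrow> j < m \<Longrightarrow> maps_into (A j - mat a) S U"
      and wU: "\<And>j. k + 3 \<le> j \<Longrightarrow> j < m \<Longrightarrow> (A j - mat a) *v w \<in> U"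
      by auto
    let ?S = "vec.span (insert w S)" and ?w = "A (k + 1) *v (A (k + 2) *v w)"
    have wS: "w \<notin> S" using SU[of "k + 2"] w(2) Suc.prems by (auto simp: maps_into_def)
    have "?S \<subseteq> W" using S w(1) sW by (intro vec.span_minimal) auto
    moreover have "vec.dim ?S = vec.dim U + Suc k"
      using dim_insert_subspace[OF S(1) wS] S(3) by simp
    moreover have "?w \<in> W" using mW[of "k + 1"] mW[of "k + 2"] w(1) Suc.prems by (auto simp: maps_into_def)
    moreover have "maps_into (A j - mat a) ?S U" if "k + 3 \<le> j" "j < m" for j
      using SU[of j] wU[of j] that by (intro maps_into_span_insert[OF S(1) sU]) auto
    moreover have "(A j - mat a) *v ?w \<in> U" if j: "k + 4 \<le> j" "j < m" for j
    proof -
      have comm: "A j ** A (k + 1) = A (k + 1) ** A j" "A j ** A (k + 2) = A (k + 2) ** A j"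
        using j by (auto intro!: braid_rep_commute[OF A])
      have "(A j - mat a) *v ?w = A (k + 1) *v (A (k + 2) *v ((A j - mat a) *v w))"
        using comm[THEN matrix_commute_vector]
        by (simp add: matrix_vector_mult_diff_rdistrib matrix_vector_mult_diff_distrib
            vector_scalar_commute)
      then show ?thesis
        using wU[of j] j mU[of "k + 1"] mU[of "k + 2"] by (auto simp: maps_into_def)
    qed
    moreover have "(A (k + 3) - mat a) *v ?w \<notin> U"
    proof
      let ?X = "A (k + 2)" and ?Y = "A (k + 3)"
      assume *: "(?Y - mat a) *v ?w \<in> U"
      have comm: "?Y ** A (k + 1) = A (k + 1) ** ?Y"
        using Suc.prems by (intro braid_rep_commute[OF A]) auto
      have "(?Y - mat a) *v ?w = A (k + 1) *v ((?Y - mat a) *v (?X *v w))"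
        using comm[THEN matrix_commute_vector]
        by (simp add: matrix_vector_mult_diff_rdistrib matrix_vector_mult_diff_distrib
            vector_scalar_commute)
      then have 1: "(?Y - mat a) *v (?X *v w) \<in> U"
        using * mem_if_invertible_image_mem[OF braid_rep_invertible[OF A, of "k + 1"] sU mU]
          Suc.prems by auto
      have 2: "(?Y - mat a) *v w \<in> U" using wU Suc.prems by auto
      have mX: "maps_into ?X U U" and mY: "maps_into ?Y U U" and iX: "invertible ?X"
        using Suc.prems by (auto intro!: mU braid_rep_invertible[OF A])
      have braid: "?X *v (?Y *v (?X *v w)) = ?Y *v (?X *v (?Y *v w))"
        using braid_rep_braid[OF A, of "k + 2"] Suc.prems
        by (simp add: matrix_vector_mul_assoc matrix_mul_assoc eval_nat_numeral)
      \<comment> \<open>Every term lies in \<open>U\<close> by 1 and 2. Expanding, the braid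
        relation cancels the cubic terms and leaves a multiple of X(X - a)w, which is not in
        \<open>U\<close>.\<close>
      have "?Y *v (?X *v ((?Y - mat a) *v w)) + a *s ((?Y - mat a) *v (?X *v w))
          - ?X *v ((?Y - mat a) *v (?X *v w)) \<in> U"
        using 1 2 mX mY sU
        by (intro vec.subspace_diff vec.subspace_add vec.subspace_scale) (auto simp: maps_into_def)
      moreover have "?Y *v (?X *v ((?Y - mat a) *v w)) + a *s ((?Y - mat a) *v (?X *v w))
          - ?X *v ((?Y - mat a) *v (?X *v w)) = a *s (?X *v ((?X - mat a) *v w))"
        using braid
        by (simp add: matrix_vector_mult_diff_rdistrib matrix_vector_mult_diff_distrib
            vector_scalar_commute vec.scale_right_diff_distrib)
      ultimately have "a *s (?X *v ((?X - mat a) *v w)) \<in> U" by simp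
      then have "inverse a *s (a *s (?X *v ((?X - mat a) *v w))) \<in> U"
        by (rule vec.subspace_scale[OF sU])
      then have "?X *v ((?X - mat a) *v w) \<in> U" using a0 by simp
      then show False
        using mem_if_invertible_image_mem[OF iX sU mX] w(2) by blast
    qed
    ultimately show ?case
      by (intro exI[of _ ?S] exI[of _ ?w]) (auto simp: eval_nat_numeral)
  qed
  \<comment> \<open>At the last index there are m - 3 translates in \<open>S\<close>, and
    \<open>w\<close> is one more, so W/U has dimension at least m - 2.\<close>
  obtain S w where S: "vec.subspace S" "S \<subseteq> W" "vec.dim S = vec.dim U + (m - 3)" and w: "w \<in> W"
    and n: "(A (m - 3 + 2) - mat a) *v w \<notin> U" and k: "maps_into (A (m - 3 + 2) - mat a) S U"
    using chain[of "m - 3"] m by auto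
  have "w \<notin> S" using n k by (auto simp: maps_into_def)
  moreover have "vec.span (insert w S) \<subseteq> W" using S w sW by (intro vec.span_minimal) auto
  ultimately have "vec.dim U + (m - 3) + 1 \<le> vec.dim W"
    using dim_insert_subspace[OF S(1), of w] S(3) vec.dim_subset by metis
  then show ?thesis using m by linarith
qed

lemma eq_span_insert_if_dim:
  fixes U :: "('a::field^'n) set"
  assumes "vec.subspace U" "vec.subspace W" "U \<subseteq> W" "w \<in> W" "w \<notin> U" "vec.dim W = vec.dim U + 1"
  shows "W = vec.span (insert w U)"
proof (rule vec.subspace_dim_equal[symmetric])
  show "vec.span (insert w U) \<subseteq> W"
    using assms by (intro vec.span_minimal) auto
  show "vec.dim W \<le> vec.dim (vec.span (insert w U))"
    using dim_insert_subspace[OF assms(1,5)] assms(6) by simp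
qed (use assms in auto)

section \<open>Generators coincide on small subquotients\<close>

theorem agree_mod_if_dim_small:
  fixes A :: "nat \<Rightarrow> complex^'n^'n"
  assumes "braid_rep m A" "5 \<le> m" "invariant m A U" "invariant m A W" "U \<subseteq> W"
    and "vec.dim W + 3 \<le> vec.dim U + m"
  shows "agree_mod m A W U"
  using assms
proof (induction "vec.dim W - vec.dim U" arbitrary: m A U W rule: less_induct)
  case less
  note A = less.prems(1) and m = less.prems(2) and U = less.prems(3) and W = less.prems(4)
    and UW = less.prems(5) and small = less.prems(6)
  have sU: "vec.subspace U" and sW: "vec.subspace W"
    using U W by (auto simp: invariant_def)
  have mU: "maps_into (A i) U U" and mW: "maps_into (A i) W W" if "1 \<le> i" "i < m" for i
    using U W that by (auto simp: invariant_def)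
  have IH: "agree_mod m' A' W' U'"
    if "braid_rep m' A'" "5 \<le> m'" "invariant m' A' U'" "invariant m' A' W'" "U' \<subseteq> W'"
      "vec.dim W' + 3 \<le> vec.dim U' + m'" "vec.dim W' - vec.dim U' < vec.dim W - vec.dim U"
    for m' A' U' and W' :: "(complex^'n) set"
    using less.hyps that by blast
  \<comment> \<open>Zero, reducible or irreducible subquotient. A reducible one is handled by gluing
    two smaller ones.\<close>
  consider "U = W" | X where "invariant m A X" "U \<subset> X" "X \<subset> W"
    | "U \<subset> W" "\<And>X. invariant m A X \<Longrightarrow> U \<subseteq> X \<Longrightarrow> X \<subseteq> W \<Longrightarrow> X = U \<or> X = W"
    using UW by blast
  then show ?case
  proof cases
    case 1
    then show ?thesis
      using mW sW by (auto simp: agree_mod_def intro!: maps_into_diff)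
  next
    case (2 X)
    then have "vec.subspace X" by (simp add: invariant_def)
    then have dims: "vec.dim U < vec.dim X" "vec.dim X < vec.dim W"
      using 2 sU sW by (auto intro: dim_psubset_subspace)
    have "agree_mod m A W X" by (rule IH[OF A m 2(1) W]) (use 2 dims small in auto)
    moreover have "agree_mod m A X U" by (rule IH[OF A m U 2(1)]) (use 2 dims small in auto)
    ultimately show ?thesis by (rule agree_mod_glue[OF A m U W])
  next
    case 3
    note irr = 3(2)
    have m1: "maps_into (A 1) W W" using mW m by auto
    then have "A 1 *v w \<in> W" if "w \<in> W" for w using that by (simp add: maps_into_def)
    then obtain c w where w: "w \<in> W" "w \<notin> U" "A 1 *v w - c *s w \<in> U"
      by (rule eigenvector_subquotient[OF sU sW 3(1)])
    define N where "N = A 1 - mat c"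
    \<comment> \<open>E/U is the eigenspace of \<open>A 1\<close> on W/U for the eigenvalue
      \<open>c\<close>.\<close>
    define E where "E = {w \<in> W. N *v w \<in> U}"
    have NW: "maps_into N W W"
      unfolding N_def using m1 sW by (intro maps_into_diff) (auto simp: maps_into_def vec.subspace_scale)
    have NU: "maps_into N U U"
      unfolding N_def using mU m sU by (intro maps_into_diff) (auto simp: maps_into_def vec.subspace_scale)
    have NE: "maps_into N E U" by (auto simp: maps_into_def E_def)
    have sE: "vec.subspace E"
      using sU sW by (auto simp: vec.subspace_def E_def matrix_vector_right_distrib vector_scalar_commute)
    have EW: "E \<subseteq> W" and UE: "U \<subseteq> E" using UW NU by (auto simp: E_def maps_into_def)
    have wE: "w \<in> E" using w by (simp add: E_def N_def matrix_vector_mult_diff_rdistrib)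
    show ?thesis
    proof (cases "E = W")
      case True
      then show ?thesis using agree_mod_if_scalar[OF A U W] NE by (simp add: N_def)
    next
      case False
      have dims: "vec.dim U < vec.dim E" "vec.dim E < vec.dim W"
        using sU sE sW wE w(2) UE EW False by (auto intro!: dim_psubset_subspace)
      have comm: "N *v (A j *v x) = A j *v (N *v x)" if "1 \<le> j" "j < m" "j \<noteq> 2" for j x
      proof -
        have "A 1 ** A j = A j ** A 1" using that m by (intro braid_rep_commute[OF A]) auto
        then show ?thesis
          using matrix_commute_vector[of "A 1" "A j" x]
          by (simp add: N_def matrix_vector_mult_diff_rdistrib matrix_vector_mult_diff_distrib
              vector_scalar_commute)
      qed
      have mE: "maps_into (A j) E E" if "1 \<le> j" "j < m" "j \<noteq> 2" for j
        using comm[OF that] mW[of j] mU[of j] that by (auto simp: maps_into_def E_def)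
      \<comment> \<open>A line stable under all generators but \<open>A 2\<close> would force
        dimension at least m - 2.\<close>
      have noline: False if f: "f \<in> W" "f \<notin> U"
        and lines: "\<And>j. 1 \<le> j \<Longrightarrow> j < m \<Longrightarrow> j \<noteq> 2 \<Longrightarrow> \<exists>c. A j *v f - c *s f \<in> U" for f
        using dim_irreducible_subquotient_ge[OF A U W UW irr _ f lines] dims small by auto
      have "vec.dim E \<noteq> vec.dim U + 1"
      proof
        assume "vec.dim E = vec.dim U + 1"
        then have E: "E = vec.span (insert w U)"
          using sU sE UE wE w(2) by (intro eq_span_insert_if_dim)
        show False
        proof (rule noline[OF w(1,2)])
          fix j assume "1 \<le> j" "j < m" "j \<noteq> 2"
          then have "A j *v w \<in> E" using mE wE by (auto simp: maps_into_def)
          then show "\<exists>c. A j *v w - c *s w \<in> U" unfolding E mem_span_insert_subspace[OF sU] .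
        qed
      qed
      \<comment> \<open>Here \<open>N\<close> carries the line W/E injectively to a line in W/U, and
        it commutes with all generators other than \<open>A 2\<close>.\<close>
      moreover have "vec.dim W \<noteq> vec.dim E + 1"
      proof
        assume dim: "vec.dim W = vec.dim E + 1"
        obtain v where v: "v \<in> W" "v \<notin> E" using EW False by auto
        then have W': "W = vec.span (insert v E)"
          using sW sE EW dim by (intro eq_span_insert_if_dim)
        show False
        proof (rule noline)
          show "N *v v \<in> W" "N *v v \<notin> U" using v NW by (auto simp: maps_into_def E_def)
          fix j assume j: "1 \<le> j" "j < m" "j \<noteq> 2"
          then have "A j *v v \<in> W" using mW v by (auto simp: maps_into_def)
          then obtain k where "A j *v v - k *s v \<in> E"
            unfolding W' mem_span_insert_subspace[OF sE] by auto
          then have "N *v (A j *v v - k *s v) \<in> U" using NE by (auto simp: maps_into_def)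
          then have "A j *v (N *v v) - k *s (N *v v) \<in> U"
            by (simp add: matrix_vector_mult_diff_distrib vector_scalar_commute comm[OF j])
          then show "\<exists>c. A j *v (N *v v) - c *s (N *v v) \<in> U" by blast
        qed
      qed
      \<comment> \<open>Both W/E and E/U are smaller than W/U by at least two, which pays for the
        two lost strings. The size bound then also gives m \<ge> 7, so that at least five strings
        remain.\<close>
      ultimately have dims2: "vec.dim U + 2 \<le> vec.dim E" "vec.dim E + 2 \<le> vec.dim W"
        using dims by auto
      let ?A = "\<lambda>i. A (i + 2)"
      note A' = braid_rep_shift[OF A] and U' = invariant_shift[OF U] and W' = invariant_shift[OF W]
      have m': "5 \<le> m - 2" using dims2 small by linarith
      have E': "invariant (m - 2) ?A E" using sE mE by (auto simp: invariant_def)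
      have "agree_mod (m - 2) ?A W E" by (rule IH[OF A' m' E' W' EW]) (use dims2 small in auto)
      moreover have "agree_mod (m - 2) ?A E U" by (rule IH[OF A' m' U' E' UE]) (use dims2 small in auto)
      ultimately have "agree_mod (m - 2) ?A W U" by (rule agree_mod_glue[OF A' m' U' W'])
      then have "maps_into (?A 1 - ?A 2) W U"
        using m' unfolding agree_mod_def by (elim ballE[of _ _ 1] ballE[of _ _ 2]) auto
      then have "maps_into (A 3 - A (Suc 3)) W U" by (simp add: eval_nat_numeral)
      then show ?thesis using m' by (intro agree_mod_if_adjacent_agree[OF A U W, of 3]) auto
    qed
  qed
qed

section \<open>Irreducible representations\<close>

lemma irreducible_invariant:
  assumes "irreducible_braid_rep n A" "invariant n A V"
  shows "V = {0} \<or> V = UNIV"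
  using assms unfolding irreducible_braid_rep_def invariant_def maps_into_def by blast

text \<open>If all generators coincided, an eigenvector of \<open>A 1\<close> would span an
  invariant line.\<close>

lemma irreducible_not_agree:
  fixes A :: "nat \<Rightarrow> complex^'n^'n"
  assumes irr: "irreducible_braid_rep n A" and n: "2 \<le> n" and card: "2 \<le> CARD('n)"
  shows "\<not> agree_mod n A UNIV {0}"
proof
  assume agree: "agree_mod n A UNIV {0}"
  have "{0 :: complex^'n} \<subset> UNIV"
    using axis_eq_0_iff[of undefined "1 :: complex"] by blast
  then obtain c w where "w \<notin> {0}" "A 1 *v w - c *s w \<in> {0}"
    by (rule eigenvector_subquotient[rotated 2]) auto
  then have w: "w \<noteq> 0" "A 1 *v w = c *s w" by auto
  have "A i *v w = c *s w" if "1 \<le> i" "i < n" for i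
  proof -
    have "maps_into (A i - A 1) UNIV {0}" using agree n that by (simp add: agree_mod_def)
    then have "A i *v w - A 1 *v w = 0"
      unfolding maps_into_def matrix_vector_mult_diff_rdistrib by blast
    then show ?thesis using w(2) by simp
  qed
  then have "maps_into (A i) (vec.span {w}) (vec.span {w})" if "1 \<le> i" "i < n" for i
    using that by (auto simp: maps_into_def vec.span_singleton vector_scalar_commute mult.commute)
  then have "invariant n A (vec.span {w})" by (auto simp: invariant_def)
  then have "vec.span {w} = {0} \<or> vec.span {w} = UNIV" by (rule irreducible_invariant[OF irr])
  moreover have "vec.span {w} \<noteq> {0}" using w(1) vec.span_base[of w "{w}"] by auto
  ultimately have "vec.dim (UNIV :: (complex^'n) set) = vec.dim {w}" by (metis vec.dim_span)
  also have "\<dots> \<le> 1" using vec.dim_le_card'[of "{w}"] by simp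
  finally show False using card by (simp add: card_cart_basis)
qed

text \<open>Take \<open>X\<close> maximal such that \<open>A 3, \<dots>, A (n - 1)\<close> coincide on \<open>X\<close>. If all eigenspaces of \<open>A 1\<close>
  were small, then \<open>X\<close> could be enlarged to the preimage of \<open>X\<close> under some \<open>A 1 - mat c\<close>.\<close>

lemma exists_large_eigenspace:
  fixes A :: "nat \<Rightarrow> complex^'n^'n"
  assumes irr: "irreducible_braid_rep n A" and n: "7 \<le> n" and card: "2 \<le> CARD('n)"
  obtains c where "c \<noteq> 0" "rank (A 1 - mat c) + n \<le> CARD('n) + 4"
proof -
  have A: "braid_rep n A" using irr by (simp add: irreducible_braid_rep_def)
  let ?A = "\<lambda>i. A (i + 2)"
  note A' = braid_rep_shift[OF A]
  \<comment> \<open>Stability under \<open>A 1\<close> is included so that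
    \<open>A 1 - mat c\<close> preserves \<open>X\<close>, making the preimage \<open>E\<close>
    below contain \<open>X\<close>.\<close>
  define P where "P X \<longleftrightarrow> maps_into (A 1) X X \<and> invariant (n - 2) ?A X \<and> agree_mod (n - 2) ?A X {0}" for X
  have "P {0}" by (auto simp: P_def maps_into_def invariant_def agree_mod_def)
  moreover have "\<forall>X. P X \<longrightarrow> vec.dim X < Suc CARD('n)"
    by (simp add: less_Suc_eq_le dim_subset_UNIV_cart_gen)
  ultimately have "\<exists>X. P X \<and> (\<forall>Y. P Y \<longrightarrow> vec.dim Y \<le> vec.dim X)"
    by (rule Lattices_Big.ex_has_greatest_nat)
  then obtain X where X: "P X" and max: "\<And>Y. P Y \<Longrightarrow> vec.dim Y \<le> vec.dim X"
    by metis
  have sX: "vec.subspace X" and X1: "maps_into (A 1) X X" and Xinv: "invariant (n - 2) ?A X"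
    and X0: "agree_mod (n - 2) ?A X {0}"
    using X by (auto simp: P_def invariant_def)
  have "X \<noteq> UNIV"
  proof
    assume "X = UNIV"
    then have "maps_into (?A 1 - ?A 2) UNIV {0}"
      using n X0 unfolding agree_mod_def by (elim ballE[of _ _ 1] ballE[of _ _ 2]) auto
    then have "maps_into (A 3 - A (Suc 3)) UNIV {0}" by (simp add: eval_nat_numeral)
    then have "agree_mod n A UNIV {0}"
      using n by (intro agree_mod_if_adjacent_agree[OF A, of _ _ 3]) (auto simp: invariant_def maps_into_def)
    then show False using irreducible_not_agree[OF irr _ card] n by auto
  qed
  then have "X \<subset> UNIV" by auto
  then obtain c w where w: "w \<notin> X" "A 1 *v w - c *s w \<in> X"
    by (rule eigenvector_subquotient[OF sX vec.subspace_UNIV]) auto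
  have "c \<noteq> 0"
  proof
    assume "c = 0"
    then have "A 1 *v w \<in> X" using w(2) by simp
    then have "w \<in> X"
      using mem_if_invertible_image_mem[OF braid_rep_invertible[OF A, of 1] sX X1] n by auto
    then show False using w(1) by blast
  qed
  define N where "N = A 1 - mat c"
  define E where "E = {x. N *v x \<in> X}"
  have sE: "vec.subspace E"
    using sX by (auto simp: vec.subspace_def E_def matrix_vector_right_distrib vector_scalar_commute)
  have NX: "maps_into N X X"
    unfolding N_def using X1 sX by (intro maps_into_diff) (auto simp: maps_into_def vec.subspace_scale)
  have XE: "X \<subseteq> E" using NX by (auto simp: E_def maps_into_def)
  have wE: "w \<in> E" using w by (simp add: E_def N_def matrix_vector_mult_diff_rdistrib)
  have mE: "maps_into (A j) E E" if "1 \<le> j" "j < n" "j \<noteq> 2" for j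
  proof -
    have "A 1 ** A j = A j ** A 1" using that n by (intro braid_rep_commute[OF A]) auto
    then have comm: "N *v (A j *v x) = A j *v (N *v x)" for x
      using matrix_commute_vector[of "A 1" "A j" x]
      by (simp add: N_def matrix_vector_mult_diff_rdistrib matrix_vector_mult_diff_distrib
          vector_scalar_commute)
    have "maps_into (A j) X X"
    proof (cases "j = 1")
      case False
      then have "j - 2 \<in> {1..<n - 2}" "j - 2 + 2 = j" using that by auto
      then show ?thesis using Xinv unfolding invariant_def by metis
    qed (use X1 in simp)
    then show ?thesis by (auto simp: maps_into_def E_def comm)
  qed
  have E': "invariant (n - 2) ?A E" using sE mE by (auto simp: invariant_def)
  have "rank N + n \<le> CARD('n) + 4"
  proof (rule ccontr)
    assume "\<not> rank N + n \<le> CARD('n) + 4"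
    \<comment> \<open>The constant 4 comes from here: a larger rank makes E/X of dimension at most
      (n - 2) - 3, the bound for a braid group on n - 2 strings.\<close>
    then have "vec.dim E + 3 \<le> vec.dim X + (n - 2)"
      using dim_vimage_le[OF sX, of N] n by (simp add: E_def)
    then have EX: "agree_mod (n - 2) ?A E X"
      using n XE by (intro agree_mod_if_dim_small[OF A' _ Xinv E']) auto
    have "agree_mod (n - 2) ?A E {0}"
      by (rule agree_mod_glue[OF A' _ _ E' EX X0]) (use n in \<open>auto simp: invariant_def maps_into_def\<close>)
    then have "P E" using E' mE n by (auto simp: P_def)
    then have "vec.dim E \<le> vec.dim X" by (rule max)
    moreover have "vec.dim X < vec.dim E"
      using w(1) wE XE sX sE by (intro dim_psubset_subspace) auto
    ultimately show False by simp
  qed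
  then show thesis using that[OF \<open>c \<noteq> 0\<close>] by (simp add: N_def)
qed

section \<open>Conjugate generators and annihilation of distant ones\<close>

lemma rank_conjugate:
  fixes M M' G :: "'a::field^'n^'n"
  assumes G: "invertible G" and conj: "G ** M = M' ** G"
  shows "rank M = rank M'"
proof -
  have "surj ((*v) G)"
    using G by (metis invertible_def matrix_right_invertible_surjective)
  then have "range ((*v) M') = range (\<lambda>x. M' *v (G *v x))"
    by (metis (no_types) fun.set_map o_def image_image)
  also have "\<dots> = (*v) G ` range ((*v) M)"
    using conj by (simp add: image_image matrix_vector_mul_assoc)
  finally have "rank M' = vec.dim ((*v) G ` range ((*v) M))" by (simp add: rank_eq_dim_range)
  also have "\<dots> = rank M"
    unfolding rank_eq_dim_range
    by (rule vec.dim_image_eq) (auto intro: inj_on_subset[OF inj_matrix_vector_mult[OF G]])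
  finally show ?thesis ..
qed

text \<open>The braid relation itself says that XY conjugates \<open>X\<close> to \<open>Y\<close>;
  the scalar part is central.\<close>

lemma conjugate_adjacent:
  fixes X Y :: "'a::field^'n^'n"
  assumes "X ** Y ** X = Y ** X ** Y"
  shows "(X ** Y) ** (X - mat c) = (Y - mat c) ** (X ** Y)"
  using arg_cong[OF assms, of "\<lambda>M. M *v x" for x] unfolding matrix_eq
  by (simp add: matrix_vector_mul_assoc[symmetric] matrix_vector_mult_diff_rdistrib
      matrix_vector_mult_diff_distrib vector_scalar_commute)

lemma commute_shifted:
  fixes X Y :: "'a::field^'n^'n"
  assumes "X ** Y = Y ** X"
  shows "X ** (Y - mat c) = (Y - mat c) ** X"
  using matrix_commute_vector[OF assms] unfolding matrix_eq
  by (simp add: matrix_vector_mul_assoc[symmetric] matrix_vector_mult_diff_rdistrib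
      matrix_vector_mult_diff_distrib vector_scalar_commute)

lemma rank_generator_eq:
  assumes A: "braid_rep n A" and i: "1 \<le> i" "i < n"
  shows "rank (A i - mat c) = rank (A 1 - mat c)"
  using i
proof (induction i rule: dec_induct)
  case (step i)
  have "rank (A i - mat c) = rank (A (Suc i) - mat c)"
    using step
    by (intro rank_conjugate[OF invertible_mult conjugate_adjacent[OF braid_rep_braid[OF A]]])
       (auto intro: braid_rep_invertible[OF A])
  then show ?case using step by simp
qed simp

text \<open>The range is stable under \<open>A 3\<close>, ..., \<open>A (n - 1)\<close>, and its
  dimension is at most (n - 2) - 3, so \<open>agree_mod_if_dim_small\<close> applies with
  \<open>U = {0}\<close>.\<close>

lemma generators_agree_on_range:
  fixes A :: "nat \<Rightarrow> complex^'n^'n"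
  assumes A: "braid_rep n A" and n: "7 \<le> n" and rank: "rank (A 1 - mat c) + 5 \<le> n"
    and i: "3 \<le> i" "i < n" and j: "3 \<le> j" "j < n"
  shows "A i ** (A 1 - mat c) = A j ** (A 1 - mat c)"
proof -
  let ?N = "A 1 - mat c" and ?A = "\<lambda>i. A (i + 2)"
  have "maps_into (A k) (range ((*v) ?N)) (range ((*v) ?N))" if "3 \<le> k" "k < n" for k
  proof -
    have "A k ** ?N = ?N ** A k"
      using that by (intro commute_shifted braid_rep_commute[OF A]) auto
    then show ?thesis by (auto simp: maps_into_def dest: matrix_commute_vector)
  qed
  then have inv: "invariant (n - 2) ?A (range ((*v) ?N))"
    by (auto simp: invariant_def intro: vec.linear_subspace_image[OF matrix_vector_mul_linear_gen])
  have "agree_mod (n - 2) ?A (range ((*v) ?N)) {0}"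
    using n rank
    by (intro agree_mod_if_dim_small[OF braid_rep_shift[OF A] _ _ inv])
       (auto simp: rank_eq_dim_range[symmetric] invariant_def maps_into_def image_iff intro!: exI[of _ 0])
  moreover have "i - 2 \<in> {1..<n - 2}" "j - 2 \<in> {1..<n - 2}" "i - 2 + 2 = i" "j - 2 + 2 = j"
    using i j by auto
  ultimately have "maps_into (A i - A j) (range ((*v) ?N)) {0}"
    unfolding agree_mod_def by metis
  then show ?thesis
    unfolding matrix_eq
    by (auto simp: maps_into_def matrix_vector_mul_assoc[symmetric] matrix_vector_mult_diff_rdistrib)
qed

lemma matrix_mult_zero [simp]:
  fixes M :: "'a::field^'n^'n"
  shows "M ** 0 = 0" "0 ** M = 0"
  unfolding matrix_eq by (simp_all add: matrix_vector_mul_assoc[symmetric])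

lemma invertible_mult_cancel:
  fixes G M :: "'a::field^'n^'n"
  assumes "invertible G" "M ** G = 0"
  shows "M = 0"
proof -
  obtain H where "G ** H = mat 1" using assms(1) by (auto simp: invertible_def)
  then have "M = (M ** G) ** H" by (simp add: matrix_mul_assoc[symmetric])
  then show ?thesis using assms(2) by simp
qed

text \<open>The product \<open>(A 1 - mat c) ** (A (n - 1) - mat c)\<close> can be rewritten so as to contain any
  prescribed \<open>A k - mat c\<close> as a factor, hence commutes with all generators.\<close>

lemma far_products_zero:
  fixes A :: "nat \<Rightarrow> complex^'n^'n"
  assumes irr: "irreducible_braid_rep n A" and n: "7 \<le> n" and card: "n \<le> CARD('n)"
    and rank: "rank (A 1 - mat c) + 5 \<le> n"
    and ij: "1 \<le> i" "i + 2 \<le> j" "j < n"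
  shows "(A i - mat c) ** (A j - mat c) = 0"
proof -
  have A: "braid_rep n A" using irr by (simp add: irreducible_braid_rep_def)
  define N where "N i = A i - mat c" for i
  have comm: "A k ** N l = N l ** A k" "N k ** N l = N l ** N k"
    if "1 \<le> k" "k < n" "1 \<le> l" "l < n" "k + 2 \<le> l \<or> l + 2 \<le> k \<or> k = l" for k l
  proof -
    show 1: "A k ** N l = N l ** A k"
      unfolding N_def using that by (intro commute_shifted braid_rep_commute[OF A]) auto
    show "N k ** N l = N l ** N k"
      using commute_shifted[OF 1[symmetric], of c] by (simp add: N_def)
  qed
  have left: "N k ** N 1 = N (n - 1) ** N 1" if "3 \<le> k" "k < n" for k
    using generators_agree_on_range[OF A n rank, of k "n - 1"] that n
    unfolding N_def matrix_eq
    by (simp add: matrix_vector_mul_assoc[symmetric] matrix_vector_mult_diff_rdistrib[of _ "mat c"])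
  have right: "N k ** N (n - 1) = N 1 ** N (n - 1)" if "1 \<le> k" "k \<le> n - 3" for k
  proof -
    have "rank (A (n - 1) - mat c) + 5 \<le> n"
      using rank_generator_eq[OF A, of "n - 1" c] rank n by simp
    then have "A k ** N (n - 1) = A 1 ** N (n - 1)"
      using generators_agree_on_range[OF braid_rep_reverse[OF A] n, of c "n - k" "n - 1"] that n
      by (simp add: N_def)
    then show ?thesis
      unfolding N_def matrix_eq
      by (simp add: matrix_vector_mul_assoc[symmetric] matrix_vector_mult_diff_rdistrib[of _ "mat c"])
  qed
  define K where "K = N 1 ** N (n - 1)"
  have K1: "K = N k ** N 1" if "3 \<le> k" "k < n" for k
    unfolding K_def left[OF that] by (rule comm(2)) (use n in auto)
  have K2: "K = N k ** N (n - 1)" if "1 \<le> k" "k \<le> n - 3" for k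
    using right[OF that] by (simp add: K_def)
  \<comment> \<open>Choose the factorization of \<open>K\<close> that contains \<open>N k\<close>
    and some \<open>N l\<close> with \<open>l\<close> far from \<open>k\<close>; then
    \<open>A k\<close> commutes with both factors.\<close>
  have commK: "A k ** K = K ** A k" if k: "1 \<le> k" "k < n" for k
  proof -
    have "\<exists>l. 1 \<le> l \<and> l < n \<and> (k + 2 \<le> l \<or> l + 2 \<le> k) \<and> K = N k ** N l"
    proof (cases "3 \<le> k")
      case True
      then show ?thesis using K1 k n by (intro exI[of _ 1]) auto
    next
      case False
      then show ?thesis using K2 k n by (intro exI[of _ "n - 1"]) auto
    qed
    then obtain l where l: "1 \<le> l" "l < n" "k + 2 \<le> l \<or> l + 2 \<le> k" "K = N k ** N l" by blast
    have "A k ** N k = N k ** A k" "A k ** N l = N l ** A k" using l k by (auto intro!: comm)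
    then show ?thesis unfolding l(4) by (metis matrix_mul_assoc)
  qed
  have "invariant n A (range ((*v) K))"
    unfolding invariant_def maps_into_def
    by (auto intro: vec.linear_subspace_image[OF matrix_vector_mul_linear_gen]
        simp: matrix_commute_vector[OF commK])
  then have "range ((*v) K) = {0} \<or> range ((*v) K) = UNIV" by (rule irreducible_invariant[OF irr])
  moreover have "range ((*v) K) \<noteq> UNIV"
  proof
    assume "range ((*v) K) = UNIV"
    moreover have "range ((*v) K) \<subseteq> range ((*v) (N 1))"
      by (auto simp: K_def matrix_vector_mul_assoc[symmetric])
    ultimately have "range ((*v) (N 1)) = UNIV" by auto
    then have "rank (N 1) = CARD('n)" by (simp add: rank_eq_dim_range card_cart_basis)
    then show False using rank card by (simp add: N_def)
  qed
  ultimately have "K = 0" unfolding matrix_eq by auto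
  \<comment> \<open>\<open>K = 0\<close> settles \<open>i = 1\<close>. Conjugation by
    \<open>A i ** A (Suc i)\<close> raises the first index while fixing \<open>N j\<close>, as long
    as the indices stay at distance two.\<close>
  have "N i ** N j = 0"
    using ij(1,2)
  proof (induction i rule: dec_induct)
    case base
    then show ?case using K1[of j] comm(2)[of 1 j] ij \<open>K = 0\<close> by simp
  next
    case (step i)
    let ?G = "A i ** A (Suc i)"
    have inv: "invertible ?G"
      using step ij by (intro invertible_mult braid_rep_invertible[OF A]) auto
    have c1: "?G ** N i = N (Suc i) ** ?G"
      unfolding N_def using step ij by (intro conjugate_adjacent braid_rep_braid[OF A]) auto
    have c2: "A i ** N j = N j ** A i" "A (Suc i) ** N j = N j ** A (Suc i)"
      using step ij by (auto intro!: comm)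
    then have c2: "?G ** N j = N j ** ?G" by (metis matrix_mul_assoc)
    have "(N (Suc i) ** N j) ** ?G = ?G ** (N i ** N j)"
      by (metis c1 c2 matrix_mul_assoc)
    also have "\<dots> = 0" using step by simp
    finally show ?case by (rule invertible_mult_cancel[OF inv])
  qed
  then show ?thesis by (simp add: N_def)
qed

section \<open>Dimension count for the ranges of the \<open>N i\<close>\<close>

lemma dim_sums_Int_trivial:
  fixes S T :: "('a::field^'n) set"
  assumes "vec.subspace S" "vec.subspace T" "S \<inter> T \<subseteq> {0}"
  shows "vec.dim {x + y |x y. x \<in> S \<and> y \<in> T} = vec.dim S + vec.dim T"
  using vec.dim_sums_Int[OF assms(1,2)] assms(3) by (simp add: vec.dim_eq_0[THEN iffD2])

locale irreducible_far_annihilating =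
  fixes n :: nat and A N :: "nat \<Rightarrow> complex^'n^'n" and c :: complex
  assumes irr: "irreducible_braid_rep n A" and n: "5 \<le> n" and card: "2 \<le> CARD('n)"
    and N: "N i = A i - mat c"
    and far: "1 \<le> i \<Longrightarrow> i + 2 \<le> j \<Longrightarrow> j < n \<Longrightarrow> N i ** N j = 0"
begin

lemma A: "braid_rep n A"
  using irr by (simp add: irreducible_braid_rep_def)

lemma N_commute:
  assumes "1 \<le> i" "i < n" "1 \<le> j" "j < n" "i + 2 \<le> j \<or> j + 2 \<le> i"
  shows "A i ** N j = N j ** A i"
  unfolding N using assms by (intro commute_shifted braid_rep_commute[OF A]) auto

lemma N_far:
  assumes "1 \<le> i" "i < n" "1 \<le> j" "j < n" "i + 2 \<le> j \<or> j + 2 \<le> i"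
  shows "N i *v (N j *v x) = 0"
proof -
  have "N i ** N j = N j ** N i"
    using commute_shifted[OF N_commute[OF assms, symmetric], of c] by (simp add: N)
  then have "N i ** N j = 0" using far[of i j] far[of j i] assms by auto
  then show ?thesis by (simp add: matrix_vector_mul_assoc)
qed

text \<open>On the common kernel every generator is the scalar \<open>c\<close>, so the kernel is
  invariant; it cannot be the whole space because the generators do not all agree.\<close>

lemma annihilated_imp_zero:
  assumes x: "\<And>k. 1 \<le> k \<Longrightarrow> k < n \<Longrightarrow> N k *v x = 0"
  shows "x = 0"
proof (rule ccontr)
  assume "x \<noteq> 0"
  let ?F = "{x. \<forall>k. 1 \<le> k \<and> k < n \<longrightarrow> N k *v x = 0}"
  have "A k *v x = c *s x" if "x \<in> ?F" "1 \<le> k" "k < n" for x k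
  proof -
    have "N k *v x = 0" using that by auto
    then show ?thesis by (simp add: N matrix_vector_mult_diff_rdistrib)
  qed
  then have "invariant n A ?F"
    by (auto simp: invariant_def maps_into_def vec.subspace_def matrix_vector_right_distrib
        vector_scalar_commute)
  then have "?F = {0} \<or> ?F = UNIV" by (rule irreducible_invariant[OF irr])
  then have F: "?F = UNIV" using x \<open>x \<noteq> 0\<close> by auto
  have "N k *v x = 0" if "1 \<le> k" "k < n" for k x
    using F that by blast
  then have "agree_mod n A UNIV {0}"
    by (auto simp: agree_mod_def maps_into_def matrix_vector_mult_diff_rdistrib N)
  then show False using irreducible_not_agree[OF irr _ card] n by auto
qed

abbreviation I :: "nat \<Rightarrow> (complex^'n) set" where "I i \<equiv> range ((*v) (N i))"

lemma subspace_I: "vec.subspace (I i)"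
  by (auto intro: vec.linear_subspace_image[OF matrix_vector_mul_linear_gen])

lemma dim_I: "1 \<le> i \<Longrightarrow> i < n \<Longrightarrow> vec.dim (I i) = rank (N 1)"
  using rank_generator_eq[OF A, of i c] by (simp add: rank_eq_dim_range N)

text \<open>Every index is at distance at least two from \<open>i\<close> or from \<open>j\<close>,
  so every \<open>N k\<close> kills \<open>x\<close>.\<close>

lemma I_Int_distance_3:
  assumes ij: "1 \<le> i" "i + 3 \<le> j" "j < n" and x: "x \<in> I i" "x \<in> I j"
  shows "x = 0"
proof (rule annihilated_imp_zero)
  fix k assume k: "1 \<le> k" "k < n"
  obtain y where "x = N i *v y" using x(1) by auto
  moreover obtain z where "x = N j *v z" using x(2) by auto
  moreover have "(k + 2 \<le> i \<or> i + 2 \<le> k) \<or> (k + 2 \<le> j \<or> j + 2 \<le> k)" using ij by linarith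
  ultimately show "N k *v x = 0"
    using N_far[of k i y] N_far[of k j z] k ij by auto
qed

text \<open>The index \<open>i + 1\<close> is adjacent to both ends, so a product of two generators
  first moves one range a step away: \<open>i\<close> to \<open>i - 1\<close>, or for
  \<open>i = 1\<close> the index 3 to 4. It fixes the other range, and distance three
  applies.\<close>

lemma I_Int_distance_2:
  assumes i: "1 \<le> i" "i + 2 < n" and x: "x \<in> I i" "x \<in> I (i + 2)"
  shows "x = 0"
proof -
  have braid: "A k ** A (Suc k) ** A k = A (Suc k) ** A k ** A (Suc k)" if "1 \<le> k" "Suc k < n" for k
    using that by (rule braid_rep_braid[OF A])
  have inv: "invertible (A k ** A l)" if "1 \<le> k" "k < n" "1 \<le> l" "l < n" for k l
    using that by (intro invertible_mult braid_rep_invertible[OF A])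
  have move: "G *v x \<in> I l" if "G ** N k = N l ** G" "x \<in> I k" for G k l
    using that by (auto simp: matrix_vector_mul_assoc) (simp add: matrix_vector_mul_assoc[symmetric])
  obtain G :: "complex^'n^'n" where G: "invertible G" "G *v x = 0"
  proof (cases "2 \<le> i")
    case True
    then obtain h where h: "i = Suc h" "1 \<le> h" by (cases i) auto
    let ?G = "A (Suc h) ** A h"
    have "?G ** N (Suc h) = N h ** ?G"
      unfolding N using h i by (intro conjugate_adjacent braid[symmetric]) auto
    then have 1: "?G *v x \<in> I h" using x h by (intro move) auto
    have "A h ** N (i + 2) = N (i + 2) ** A h" "A (Suc h) ** N (i + 2) = N (i + 2) ** A (Suc h)"
      using h i by (auto intro!: N_commute)
    then have "?G ** N (i + 2) = N (i + 2) ** ?G" by (metis matrix_mul_assoc)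
    then have 2: "?G *v x \<in> I (i + 2)" using x by (intro move)
    have "invertible ?G" using h i by (intro inv) auto
    moreover have "?G *v x = 0" by (rule I_Int_distance_3[OF _ _ _ 1 2]) (use h i in auto)
    ultimately show ?thesis by (rule that)
  next
    case False
    then have i1: "i = 1" using i by simp
    let ?G = "A 3 ** A (Suc 3)"
    have "?G ** N 3 = N (Suc 3) ** ?G"
      unfolding N using n by (intro conjugate_adjacent braid) auto
    moreover have "x \<in> I 3" using x(2) by (simp add: i1 eval_nat_numeral)
    ultimately have 2: "?G *v x \<in> I (Suc 3)" by (rule move)
    have "A 3 ** N 1 = N 1 ** A 3" "A (Suc 3) ** N 1 = N 1 ** A (Suc 3)"
      using n by (auto intro!: N_commute)
    then have "?G ** N 1 = N 1 ** ?G" by (metis matrix_mul_assoc)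
    then have 1: "?G *v x \<in> I 1" using x i1 by (intro move) auto
    have "invertible ?G" using n by (intro inv) auto
    moreover have "?G *v x = 0" by (rule I_Int_distance_3[OF _ _ _ 1 2]) (use n in auto)
    ultimately show ?thesis by (rule that)
  qed
  then show ?thesis using inj_matrix_vector_mult[OF G(1)] by (metis injD matrix_vector_mult_0_right)
qed

definition P :: "nat \<Rightarrow> (complex^'n) set" where
  "P m = vec.span (\<Union>i\<in>{1..m}. I i)"

lemma subspace_P: "vec.subspace (P m)"
  by (simp add: P_def)

lemma I_subset_P: "1 \<le> i \<Longrightarrow> i \<le> m \<Longrightarrow> I i \<subseteq> P m"
  unfolding P_def by (intro subset_trans[OF _ vec.span_superset] UN_upper) auto

lemma P_mono: "m \<le> m' \<Longrightarrow> P m \<subseteq> P m'"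
  unfolding P_def by (intro vec.span_mono UN_mono) auto

lemma P_annihilated:
  assumes "x \<in> P m" "m + 2 \<le> k" "k < n"
  shows "N k *v x = 0"
proof -
  have "P m \<subseteq> {x. N k *v x = 0}"
    unfolding P_def
  proof (rule vec.span_minimal)
    show "(\<Union>i\<in>{1..m}. I i) \<subseteq> {x. N k *v x = 0}"
      using assms(2,3) by (auto intro!: N_far)
    show "vec.subspace {x. N k *v x = 0}"
      by (auto simp: vec.subspace_def matrix_vector_right_distrib vector_scalar_commute)
  qed
  then show ?thesis using assms(1) by auto
qed

lemma dim_I_sum:
  assumes "1 \<le> i" "i + 2 < n"
  shows "vec.dim {x + y |x y. x \<in> I i \<and> y \<in> I (i + 2)} = 2 * rank (N 1)"
  using assms dim_I[of i] dim_I[of "i + 2"] I_Int_distance_2[OF assms]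
  by (subst dim_sums_Int_trivial) (auto simp: subspace_I simp del: add_2_eq_Suc')

text \<open>For k \<ge> m + 2, \<open>N k\<close> kills \<open>P m\<close>; for smaller k it kills
  \<open>I (m + 3)\<close> and \<open>I (m + 5)\<close>. A common vector is therefore killed by all
  \<open>N k\<close>, so five further indices contribute two independent ranges.\<close>

lemma dim_P_step:
  assumes m: "m + 5 < n"
  shows "vec.dim (P m) + 2 * rank (N 1) \<le> vec.dim (P (m + 5))"
proof -
  let ?T = "{x + y |x y. x \<in> I (m + 3) \<and> y \<in> I (m + 5)}"
  have five: "m + 3 + 2 = m + 5" by simp
  have sT: "vec.subspace ?T" by (rule vec.subspace_sums) (rule subspace_I)+
  have "z = 0" if "z \<in> P m" "z \<in> ?T" for z
  proof (rule annihilated_imp_zero)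
    fix k assume k: "1 \<le> k" "k < n"
    obtain u v where uv: "z = N (m + 3) *v u + N (m + 5) *v v" using \<open>z \<in> ?T\<close> by auto
    show "N k *v z = 0"
    proof (cases "m + 2 \<le> k")
      case True
      then show ?thesis using P_annihilated[OF \<open>z \<in> P m\<close>] k by auto
    next
      case False
      then show ?thesis
        using N_far[of k "m + 3" u] N_far[of k "m + 5" v] k m
        by (simp add: uv matrix_vector_right_distrib)
    qed
  qed
  then have "P m \<inter> ?T \<subseteq> {0}" by blast
  then have "vec.dim {x + y |x y. x \<in> P m \<and> y \<in> ?T} = vec.dim (P m) + vec.dim ?T"
    by (rule dim_sums_Int_trivial[OF subspace_P sT])
  moreover have "vec.dim ?T = 2 * rank (N 1)"
    using dim_I_sum[of "m + 3"] m unfolding five by simp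
  moreover have "vec.dim {x + y |x y. x \<in> P m \<and> y \<in> ?T} \<le> vec.dim (P (m + 5))"
  proof (rule vec.dim_subset)
    have "P m \<subseteq> P (m + 5)" "I (m + 3) \<subseteq> P (m + 5)" "I (m + 5) \<subseteq> P (m + 5)"
      by (intro P_mono I_subset_P; simp)+
    then show "{x + y |x y. x \<in> P m \<and> y \<in> ?T} \<subseteq> P (m + 5)"
      by (blast intro: vec.subspace_add[OF subspace_P])
  qed
  ultimately show ?thesis by linarith
qed

text \<open>Induction in steps of five. One range suffices for m \<le> 2, and two independent ones
  for m = 3 and m = 4.\<close>

lemma dim_P_ge: "m < n \<Longrightarrow> 2 * rank (N 1) * m \<le> 5 * vec.dim (P m)"
proof (induction m rule: less_induct)
  case (less m)
  have one: "rank (N 1) \<le> vec.dim (P m)" if "1 \<le> m"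
    using vec.dim_subset[OF I_subset_P[of 1 m]] dim_I[of 1] that n by simp
  have two: "2 * rank (N 1) \<le> vec.dim (P m)" if "3 \<le> m"
  proof -
    have "I 1 \<subseteq> P m" "I (1 + 2) \<subseteq> P m" using that by (intro I_subset_P; simp)+
    then have "{x + y |x y. x \<in> I 1 \<and> y \<in> I (1 + 2)} \<subseteq> P m"
      by (blast intro: vec.subspace_add[OF subspace_P])
    then have "vec.dim {x + y |x y. x \<in> I 1 \<and> y \<in> I (1 + 2)} \<le> vec.dim (P m)"
      by (rule vec.dim_subset)
    moreover have "vec.dim {x + y |x y. x \<in> I 1 \<and> y \<in> I (1 + 2)} = 2 * rank (N 1)"
      by (rule dim_I_sum) (use n in auto)
    ultimately show ?thesis by linarith
  qed
  have "m = 0 \<or> m = 1 \<or> m = 2 \<or> m = 3 \<or> m = 4 \<or> (\<exists>k. m = k + 5)" by presburger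
  then consider "m = 0" | "m = 1" | "m = 2" | "m = 3" | "m = 4" | k where "m = k + 5"
    by blast
  then show ?case
  proof cases
    case (6 k)
    then have "2 * rank (N 1) * k \<le> 5 * vec.dim (P k)" using less by simp
    then show ?thesis using dim_P_step[of k] 6 less.prems by (simp add: algebra_simps)
  qed (use one two in auto)
qed

lemma dim_P_le: "m < n \<Longrightarrow> vec.dim (P m) \<le> rank (N 1) * m"
proof (induction m)
  case 0
  have "P 0 = {0}" by (simp add: P_def)
  then show ?case by simp
next
  case (Suc m)
  have "{1..Suc m} = insert (Suc m) {1..m}" by auto
  then have "P (Suc m) = vec.span ((\<Union>i\<in>{1..m}. I i) \<union> I (Suc m))"
    unfolding P_def by (simp add: Un_commute)
  also have "\<dots> = {x + y |x y. x \<in> P m \<and> y \<in> I (Suc m)}"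
    unfolding vec.span_Un P_def vec.span_eq_iff[THEN iffD2, OF subspace_I] ..
  finally have "vec.dim (P (Suc m)) \<le> vec.dim (P m) + vec.dim (I (Suc m))"
    using vec.dim_sums_Int[OF subspace_P subspace_I, of m "Suc m"] by simp
  then show ?case using Suc dim_I[of "Suc m"] by simp
qed

text \<open>As A k = N k + c, the sum of all ranges is invariant; it is nonzero because the
  \<open>N k\<close> do not all vanish.\<close>

lemma P_full: "P (n - 1) = UNIV"
proof -
  have "maps_into (A k) (P (n - 1)) (P (n - 1))" if k: "1 \<le> k" "k < n" for k
    unfolding maps_into_def
  proof
    fix x assume "x \<in> P (n - 1)"
    moreover have "I k \<subseteq> P (n - 1)" using k by (intro I_subset_P) auto
    then have "N k *v x \<in> P (n - 1)" by blast
    ultimately have "N k *v x + c *s x \<in> P (n - 1)"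
      by (intro vec.subspace_add vec.subspace_scale subspace_P)
    then show "A k *v x \<in> P (n - 1)" by (simp add: N matrix_vector_mult_diff_rdistrib)
  qed
  then have "invariant n A (P (n - 1))" by (auto simp: invariant_def subspace_P)
  then have "P (n - 1) = {0} \<or> P (n - 1) = UNIV" by (rule irreducible_invariant[OF irr])
  moreover have "P (n - 1) \<noteq> {0}"
  proof
    assume *: "P (n - 1) = {0}"
    have zero: "N k *v x = 0" if "1 \<le> k" "k < n" for k x
    proof -
      have "I k \<subseteq> P (n - 1)" using that by (intro I_subset_P) auto
      then show ?thesis unfolding * by blast
    qed
    have "axis undefined 1 = (0 :: complex^'n)" by (rule annihilated_imp_zero) (rule zero)
    then show False by (simp add: axis_eq_0_iff)
  qed
  ultimately show ?thesis by blast
qed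

lemma rank_bounds:
  "2 * rank (N 1) * (n - 1) \<le> 5 * CARD('n)" "CARD('n) \<le> rank (N 1) * (n - 1)"
  using dim_P_ge[of "n - 1"] dim_P_le[of "n - 1"] n unfolding P_full
  by (simp_all add: card_cart_basis)

end

lemma exists_rank_2:
  fixes \<rho> :: "nat \<Rightarrow> complex^'n^'n"
  assumes card9: "9 \<le> CARD('n)" and irr: "irreducible_braid_rep CARD('n) \<rho>"
  obtains y where "y \<noteq> 0" "rank (\<rho> 1 - mat y) = 2"
proof -
  obtain y where y: "y \<noteq> 0" "rank (\<rho> 1 - mat y) + CARD('n) \<le> CARD('n) + 4"
    using exists_large_eigenspace[OF irr] card9 by auto
  \<comment> \<open>Dimension at least 9 is what turns rank at most 4 into the condition rank + 5
    \<le> n of \<open>far_products_zero\<close>.\<close>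
  interpret irreducible_far_annihilating "CARD('n)" \<rho> "\<lambda>i. \<rho> i - mat y" y
    using card9 y(2) by unfold_locales (auto intro!: irr far_products_zero[OF irr])
  let ?r = "rank (\<rho> 1 - mat y)"
  have "?r \<noteq> 0"
  proof
    assume "?r = 0"
    then show False using rank_bounds(2) card9 by simp
  qed
  moreover have "?r \<noteq> 1"
  proof
    assume "?r = 1"
    then show False using rank_bounds(2) card9 by simp
  qed
  moreover have "?r < 3"
  proof (rule ccontr)
    assume "\<not> ?r < 3"
    \<comment> \<open>Rank at least 3 would give 6(n - 1) \<le> 5n, that is n \<le> 6.\<close>
    then have "6 * (CARD('n) - 1) \<le> 2 * ?r * (CARD('n) - 1)" by (intro mult_right_mono) auto
    then show False using rank_bounds(1) card9 by linarith
  qed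
  ultimately have "?r = 2" by linarith
  then show thesis using that y(1) by blast
qed

theorem theorem3:
  fixes \<rho> :: "nat \<Rightarrow> complex^'n^'n"
  assumes "CARD('n) \<ge> 9"
    and "irreducible_braid_rep CARD('n) \<rho>"
  shows "(\<exists>y \<rho>'. y \<noteq> 0 \<and> braid_rep CARD('n) \<rho>' \<and> braid_corank \<rho>' = 2 \<and>
            equiv_braid_rep CARD('n) \<rho> (chi_tensor y \<rho>'))
       \<and> (\<exists>y. y \<noteq> 0 \<and> rank (\<rho> 1 - mat y) = 2)"
proof -
  obtain y where y: "y \<noteq> 0" "rank (\<rho> 1 - mat y) = 2"
    by (rule exists_rank_2[OF assms])
  \<comment> \<open>Untwisting by the scalar makes the equivalence with
    \<open>chi_tensor y \<rho>'\<close> an equality, so the identity matrix intertwines.\<close>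
  define \<rho>' where "\<rho>' i = mat (inverse y) ** \<rho> i" for i
  have scalar: "mat a ** M *v x = a *s (M *v x)" for a :: complex and M :: "complex^'n^'n" and x
    by (simp add: matrix_vector_mul_assoc[symmetric])
  have A: "braid_rep CARD('n) \<rho>" using assms(2) by (simp add: irreducible_braid_rep_def)
  have "braid_rep CARD('n) \<rho>'"
    unfolding braid_rep_def
  proof (intro conjI ballI allI impI)
    have "mat y ** mat (inverse y) = (mat 1 :: complex^'n^'n)"
      "mat (inverse y) ** mat y = (mat 1 :: complex^'n^'n)"
      using y(1) unfolding matrix_eq by (simp_all add: scalar)
    then have "invertible (mat (inverse y) :: complex^'n^'n)" unfolding invertible_def by blast
    then show "invertible (\<rho>' i)" if "i \<in> {1..<CARD('n)}" for i
      using braid_rep_invertible[OF A, of i] that by (auto simp: \<rho>'_def intro!: invertible_mult)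
  next
    fix i assume "1 \<le> i \<and> i + 1 < CARD('n)"
    then have "\<rho> i ** \<rho> (i + 1) ** \<rho> i = \<rho> (i + 1) ** \<rho> i ** \<rho> (i + 1)"
      using braid_rep_braid[OF A, of i] by simp
    from arg_cong[OF this, of "\<lambda>M. M *v x" for x]
    show "\<rho>' i ** \<rho>' (i + 1) ** \<rho>' i = \<rho>' (i + 1) ** \<rho>' i ** \<rho>' (i + 1)"
      unfolding matrix_eq \<rho>'_def
      by (simp add: matrix_vector_mul_assoc[symmetric] vector_scalar_commute)
  next
    fix i j assume "1 \<le> i \<and> j < CARD('n) \<and> i + 2 \<le> j"
    then have "\<rho> i ** \<rho> j = \<rho> j ** \<rho> i" by (intro braid_rep_commute[OF A]) auto
    from matrix_commute_vector[OF this]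
    show "\<rho>' i ** \<rho>' j = \<rho>' j ** \<rho>' i"
      unfolding matrix_eq \<rho>'_def
      by (simp add: matrix_vector_mul_assoc[symmetric] vector_scalar_commute)
  qed
  moreover have "braid_corank \<rho>' = 2"
  proof -
    let ?N = "\<rho> 1 - mat y" and ?N' = "\<rho>' 1 - mat 1"
    \<comment> \<open>The two matrices differ by the nonzero factor \<open>y\<close>, so their
      ranges, and hence their ranks, coincide.\<close>
    have "?N' *v x = ?N *v (inverse y *s x)" and "?N *v x = ?N' *v (y *s x)" for x
      using y(1) unfolding \<rho>'_def
      by (simp_all add: matrix_vector_mult_diff_rdistrib scalar vector_scalar_commute del: mat_mult_vector)
         (simp_all add: vec.scale_right_diff_distrib)
    then have "range ((*v) ?N') = range ((*v) ?N)" by (metis (no_types, lifting) image_subset_iff rangeI subset_antisym)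
    then show ?thesis using y(2) by (simp add: braid_corank_def rank_eq_dim_range)
  qed
  moreover have "equiv_braid_rep CARD('n) \<rho> (chi_tensor y \<rho>')"
    unfolding equiv_braid_rep_def
  proof (intro exI conjI ballI)
    show "invertible (mat 1 :: complex^'n^'n)" by (auto simp: invertible_def)
    show "mat 1 ** \<rho> i = chi_tensor y \<rho>' i ** mat 1" for i
      using y(1) unfolding matrix_eq chi_tensor_def \<rho>'_def by (simp add: scalar)
  qed
  ultimately show ?thesis using y by blast
qed

end
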